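(* Let $p>0$ be a prime and let $(R,\mathfrak{m},K)$ be a standard graded $K$-algebra over a field $K$ of characteristic $p$, such that $R$ is $F$-finite and $F$-pure. Then ${\operatorname{fpt}}(R)\leq -a_i(R)$ for every $i\in\mathbb{N}$.
   Context: A standard graded $K$-algebra $(R,\mathfrak{m},K)$ is a Noetherian ring $R=\bigoplus_{i\geq 0}R_i$ with $R_iR_j\subseteq R_{i+j}$, $R_0=K$ a field, $\dim_K R_1<\infty$ and $R=K[R_1]$; $\mathfrak{m}=\bigoplus_{i\geq 1}R_i$. $R$ is $F$-finite if $R$ is finitely generated as a module over itself via Frobenius (equivalently $[K:K^p]<\infty$); $R$ is $F$-pure if the Frobenius map $R\to R$ is pure (for $F$-finite $R$ this is equivalent to $R\hookrightarrow R^{1/p}$ splitting as $R$-modules); $F$-pure rings are reduced. For $i\in\mathbb{N}$, $a_i(R)=\max\{\alpha\in\mathbb{Z} : H^i_\mathfrak{m}(R)_\alpha\neq 0\}$ if $H^i_\mathfrak{m}(R)\neq 0$ and $a_i(R)=-\infty$ otherwise, where $H^i_\mathfrak{m}(R)$ is the (graded) local cohomology. For a homogeneous ideal $I$ and real $\lambda\geq 0$, the pair $(R,I^\lambda)$ is $F$-pure if for every $e\gg 0$ there is $f\in I^{\lfloor (p^e-1)\lambda\rfloor}$ such that the $R$-module inclusion $f^{1/p^e}R\subseteq R^{1/p^e}$ splits. ${\operatorname{fpt}}(I)=\sup\{\lambda\geq 0 : (R,I^\lambda)\text{ is }F\text{-pure}\}$ and ${\operatorname{fpt}}(R)={\operatorname{fpt}}(\mathfrak{m})$.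 The inequality is trivially true when $a_i(R)=-\infty$.
   Formalization: In the definition of F-purity of a pair, "the inclusion f^{1/p^e}R ⊆ R^{1/p^e} splits" is taken in the standard sense that the R-linear map R → R^{1/p^e}, 1 ↦ f^{1/p^e}, splits; read literally, f = 0 would always qualify and fpt(R) would be infinite. *)

theory Defs
  imports "HOL-Library.Extended_Real" "HOL-Computational_Algebra.Primes"
begin

(* The ring R is the whole type 'a; the grading is G :: nat => 'a set, G i = R_i. *)

definition graded_ring :: "(nat \<Rightarrow> 'a::comm_ring_1 set) \<Rightarrow> bool" where
  "graded_ring G \<longleftrightarrow>
     (\<forall>i. 0 \<in> G i \<and> (\<forall>x\<in>G i. \<forall>y\<in>G i. x + y \<in> G i) \<and> (\<forall>x\<in>G i. - x \<in> G i)) \<and>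
     (\<forall>i j. \<forall>x\<in>G i. \<forall>y\<in>G j. x * y \<in> G (i + j)) \<and>
     (\<forall>x. \<exists>!f. finite {i. f i \<noteq> 0} \<and> (\<forall>i. f i \<in> G i) \<and> x = (\<Sum>i\<in>{i. f i \<noteq> 0}. f i))"

definition degree0_field :: "(nat \<Rightarrow> 'a::comm_ring_1 set) \<Rightarrow> bool" where
  "degree0_field G \<longleftrightarrow> (1::'a) \<noteq> 0 \<and> 1 \<in> G 0 \<and>
     (\<forall>x\<in>G 0. x \<noteq> 0 \<longrightarrow> (\<exists>y\<in>G 0. x * y = 1))"

definition spans_deg1 :: "(nat \<Rightarrow> 'a::comm_ring_1 set) \<Rightarrow> 'a list \<Rightarrow> bool" where
  "spans_deg1 G xs \<longleftrightarrow> set xs \<subseteq> G 1 \<and>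
     (\<forall>y\<in>G 1. \<exists>c. (\<forall>j. c j \<in> G 0) \<and> y = (\<Sum>j<length xs. c j * xs ! j))"

inductive_set gen_alg :: "(nat \<Rightarrow> 'a::comm_ring_1 set) \<Rightarrow> 'a set" for G where
  base0: "x \<in> G 0 \<Longrightarrow> x \<in> gen_alg G"
| base1: "x \<in> G 1 \<Longrightarrow> x \<in> gen_alg G"
| add: "x \<in> gen_alg G \<Longrightarrow> y \<in> gen_alg G \<Longrightarrow> x + y \<in> gen_alg G"
| neg: "x \<in> gen_alg G \<Longrightarrow> - x \<in> gen_alg G"
| mult: "x \<in> gen_alg G \<Longrightarrow> y \<in> gen_alg G \<Longrightarrow> x * y \<in> gen_alg G"

definition is_ideal :: "'a::comm_ring_1 set \<Rightarrow> bool" where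
  "is_ideal I \<longleftrightarrow> 0 \<in> I \<and> (\<forall>x\<in>I. \<forall>y\<in>I. x + y \<in> I) \<and> (\<forall>r. \<forall>x\<in>I. r * x \<in> I)"

definition ideal_gen :: "'a::comm_ring_1 set \<Rightarrow> 'a set" where
  "ideal_gen S = {x. \<exists>F c. finite F \<and> F \<subseteq> S \<and> x = (\<Sum>s\<in>F. c s * s)}"

definition noetherian :: "'a::comm_ring_1 itself \<Rightarrow> bool" where
  "noetherian _ \<longleftrightarrow> (\<forall>I::'a set. is_ideal I \<longrightarrow> (\<exists>F. finite F \<and> F \<subseteq> I \<and> I = ideal_gen F))"

definition standard_graded :: "(nat \<Rightarrow> 'a::comm_ring_1 set) \<Rightarrow> bool" where
  "standard_graded G \<longleftrightarrow> noetherian TYPE('a) \<and> graded_ring G \<and> degree0_field G \<and>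
     (\<exists>xs. spans_deg1 G xs) \<and> gen_alg G = UNIV"

definition irrel_ideal :: "(nat \<Rightarrow> 'a::comm_ring_1 set) \<Rightarrow> 'a set" where
  "irrel_ideal G = {x. \<exists>f. finite {i. f i \<noteq> 0} \<and> (\<forall>i. f i \<in> G i) \<and> f 0 = 0 \<and>
      x = (\<Sum>i\<in>{i. f i \<noteq> 0}. f i)}"

fun ideal_pow :: "'a::comm_ring_1 set \<Rightarrow> nat \<Rightarrow> 'a set" where
  "ideal_pow I 0 = UNIV"
| "ideal_pow I (Suc n) = ideal_gen {a * b | a b. a \<in> I \<and> b \<in> ideal_pow I n}"

definition F_finite :: "nat \<Rightarrow> 'a::comm_ring_1 itself \<Rightarrow> bool" where
  "F_finite p _ \<longleftrightarrow> (\<exists>B::'a set. finite B \<and> (\<forall>x. \<exists>c. x = (\<Sum>b\<in>B. c b ^ p * b)))"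

(* p^e-linear maps R -> R, i.e. R-linear maps F^e_* R = R^{1/p^e} -> R *)
definition p_linear :: "nat \<Rightarrow> nat \<Rightarrow> ('a::comm_ring_1 \<Rightarrow> 'a) \<Rightarrow> bool" where
  "p_linear p e \<phi> \<longleftrightarrow> (\<forall>x y. \<phi> (x + y) = \<phi> x + \<phi> y) \<and> (\<forall>r x. \<phi> (r ^ (p ^ e) * x) = r * \<phi> x)"

(* F-pure (F-finite case): R -> R^{1/p} splits *)
definition F_pure :: "nat \<Rightarrow> 'a::comm_ring_1 itself \<Rightarrow> bool" where
  "F_pure p _ \<longleftrightarrow> (\<exists>\<phi>::'a \<Rightarrow> 'a. p_linear p 1 \<phi> \<and> \<phi> 1 = 1)"

definition pair_F_pure :: "nat \<Rightarrow> 'a::comm_ring_1 set \<Rightarrow> real \<Rightarrow> bool" where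
  "pair_F_pure p I lam \<longleftrightarrow> (\<exists>e0. \<forall>e\<ge>e0. \<exists>f \<in> ideal_pow I (nat \<lfloor>(real p ^ e - 1) * lam\<rfloor>).
      \<exists>\<phi>::'a \<Rightarrow> 'a. p_linear p e \<phi> \<and> \<phi> f = 1)"

definition fpt :: "nat \<Rightarrow> 'a::comm_ring_1 set \<Rightarrow> ereal" where
  "fpt p I = Sup (ereal ` {lam. lam \<ge> 0 \<and> pair_F_pure p I lam})"

definition hpiece :: "(nat \<Rightarrow> 'a::comm_ring_1 set) \<Rightarrow> int \<Rightarrow> 'a set" where
  "hpiece G d = (if d < 0 then {0} else G (nat d))"

definition xprod :: "'a::comm_ring_1 list \<Rightarrow> nat set \<Rightarrow> 'a" where
  "xprod xs S = (\<Prod>j\<in>S. xs ! j)"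

definition csign :: "nat set \<Rightarrow> nat \<Rightarrow> 'a::comm_ring_1" where
  "csign T s = (- 1) ^ card {t\<in>T. t < s}"

definition idx_sets :: "'a list \<Rightarrow> nat \<Rightarrow> nat set set" where
  "idx_sets xs i = {S. S \<subseteq> {..<length xs} \<and> card S = i}"

(* a Cech i-cochain of degree alpha, with components c S / (x_S)^k *)
definition cech_cochain :: "(nat \<Rightarrow> 'a::comm_ring_1 set) \<Rightarrow> 'a list \<Rightarrow> nat \<Rightarrow> int \<Rightarrow> nat \<Rightarrow> (nat set \<Rightarrow> 'a) \<Rightarrow> bool" where
  "cech_cochain G xs i \<alpha> k c \<longleftrightarrow> (\<forall>S\<in>idx_sets xs i. c S \<in> hpiece G (\<alpha> + int k * int i))"

(* numerator of (d c)_T over (x_T)^k *)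
definition cech_d :: "'a::comm_ring_1 list \<Rightarrow> nat \<Rightarrow> (nat set \<Rightarrow> 'a) \<Rightarrow> nat set \<Rightarrow> 'a" where
  "cech_d xs k c T = (\<Sum>s\<in>T. csign T s * c (T - {s}) * (xs ! s) ^ k)"

(* equality a / x_S^k = b / x_S^l in the localization R_{x_S} *)
definition loc_eq :: "'a::comm_ring_1 list \<Rightarrow> nat set \<Rightarrow> 'a \<Rightarrow> nat \<Rightarrow> 'a \<Rightarrow> nat \<Rightarrow> bool" where
  "loc_eq xs S a k b l \<longleftrightarrow> (\<exists>N. xprod xs S ^ N * (a * xprod xs S ^ l - b * xprod xs S ^ k) = 0)"

definition cech_cocycle :: "'a::comm_ring_1 list \<Rightarrow> nat \<Rightarrow> nat \<Rightarrow> (nat set \<Rightarrow> 'a) \<Rightarrow> bool" where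
  "cech_cocycle xs i k c \<longleftrightarrow> (\<forall>T\<in>idx_sets xs (Suc i). loc_eq xs T (cech_d xs k c T) k 0 0)"

definition cech_coboundary :: "(nat \<Rightarrow> 'a::comm_ring_1 set) \<Rightarrow> 'a list \<Rightarrow> nat \<Rightarrow> int \<Rightarrow> nat \<Rightarrow> (nat set \<Rightarrow> 'a) \<Rightarrow> bool" where
  "cech_coboundary G xs i \<alpha> k c \<longleftrightarrow>
     (case i of
        0 \<Rightarrow> (\<forall>S\<in>idx_sets xs 0. loc_eq xs S (c S) k 0 0)
      | Suc j \<Rightarrow> (\<exists>l b. cech_cochain G xs j \<alpha> l b \<and>
                   (\<forall>S\<in>idx_sets xs i. loc_eq xs S (c S) k (cech_d xs l b S) l)))"

definition loccoh_nonzero :: "(nat \<Rightarrow> 'a::comm_ring_1 set) \<Rightarrow> 'a list \<Rightarrow> nat \<Rightarrow> int \<Rightarrow> bool" where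
  "loccoh_nonzero G xs i \<alpha> \<longleftrightarrow> (\<exists>k c. cech_cochain G xs i \<alpha> k c \<and> cech_cocycle xs i k c \<and>
      \<not> cech_coboundary G xs i \<alpha> k c)"

(* a_i(R), with Sup {} = -\<infinity> *)
definition a_inv :: "(nat \<Rightarrow> 'a::comm_ring_1 set) \<Rightarrow> 'a list \<Rightarrow> nat \<Rightarrow> ereal" where
  "a_inv G xs i = Sup ((\<lambda>\<alpha>. ereal (real_of_int \<alpha>)) ` {\<alpha>. loccoh_nonzero G xs i \<alpha>})"

end

theory Submission
  imports Defs
begin

text \<open>
  If \<open>c\<close> is a Cech class of degree \<open>\<alpha>\<close> and \<open>\<phi>\<close> is a \<open>p\<^sup>e\<close>-linear map with \<open>\<phi> f = 1\<close>, then \<open>\<phi>\<close>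
  sends \<open>f F\<^sup>e(c)\<close> back to \<open>c\<close>. For \<open>f\<close> in the \<open>N\<close>-th power of the irrelevant ideal, \<open>f F\<^sup>e(c)\<close> has
  components only in degrees at least \<open>p\<^sup>e \<alpha> + N\<close>. Taking \<open>N = \<lfloor>(p\<^sup>e - 1) \<lambda>\<rfloor>\<close> with \<open>\<alpha> + \<lambda> > 0\<close>, these
  degrees tend to infinity with \<open>e\<close>, where local cohomology vanishes, so \<open>c = 0\<close>.

  Vanishing in large degrees is proved for \<open>R/I\<close> by Noetherian induction on the homogeneous ideal
  \<open>I\<close>. For a generator \<open>x \<notin> I\<close> of degree one, either \<open>I : x\<close> is larger than \<open>I\<close> and the sequence
  \<open>0 \<rightarrow> R/(I : x)(-1) \<rightarrow> R/I \<rightarrow> R/(I + (x)) \<rightarrow> 0\<close> applies, or \<open>x\<close> is regular on \<open>R/I\<close>; then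
  multiplication by \<open>x\<close> is injective on cohomology in large degrees but also locally nilpotent.
\<close>

section \<open>Homogeneous components\<close>

locale graded_comm_ring =
  fixes G :: "nat \<Rightarrow> 'a::comm_ring_1 set"
  assumes graded: "graded_ring G"
begin

lemma G_zero: "0 \<in> G i"
  and G_add: "x \<in> G i \<Longrightarrow> y \<in> G i \<Longrightarrow> x + y \<in> G i"
  and G_uminus: "x \<in> G i \<Longrightarrow> - x \<in> G i"
  and G_mult: "x \<in> G i \<Longrightarrow> y \<in> G j \<Longrightarrow> x * y \<in> G (i + j)"
  using graded unfolding graded_ring_def by blast+

definition hom_comp :: "'a \<Rightarrow> nat \<Rightarrow> 'a" where
  "hom_comp x = (THE f. finite {i. f i \<noteq> 0} \<and> (\<forall>i. f i \<in> G i) \<and> x = (\<Sum>i\<in>{i. f i \<noteq> 0}. f i))"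

lemma hom_comp_props:
  "finite {i. hom_comp x i \<noteq> 0} \<and> (\<forall>i. hom_comp x i \<in> G i) \<and>
     x = (\<Sum>i\<in>{i. hom_comp x i \<noteq> 0}. hom_comp x i)"
proof -
  have "\<exists>!f. finite {i. f i \<noteq> 0} \<and> (\<forall>i. f i \<in> G i) \<and> x = (\<Sum>i\<in>{i. f i \<noteq> 0}. f i)"
    using graded unfolding graded_ring_def by (elim conjE allE)
  from theI'[OF this] show ?thesis unfolding hom_comp_def .
qed

lemma finite_hom_comp: "finite {i. hom_comp x i \<noteq> 0}"
  and hom_comp_mem: "hom_comp x i \<in> G i"
  and hom_comp_sum: "(\<Sum>i\<in>{i. hom_comp x i \<noteq> 0}. hom_comp x i) = x"
  using hom_comp_props by auto

lemma hom_comp_eqI: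
  assumes "finite A" "\<And>i. f i \<in> G i" "\<And>i. i \<notin> A \<Longrightarrow> f i = 0" "x = (\<Sum>i\<in>A. f i)"
  shows "hom_comp x = f"
proof -
  have sub: "{i. f i \<noteq> 0} \<subseteq> A" using assms(3) by auto
  have "x = (\<Sum>i\<in>{i. f i \<noteq> 0}. f i)"
    unfolding assms(4) by (rule sum.mono_neutral_right[OF assms(1) sub]) auto
  moreover have "finite {i. f i \<noteq> 0}" using sub assms(1) finite_subset by blast
  ultimately have f: "finite {i. f i \<noteq> 0} \<and> (\<forall>i. f i \<in> G i) \<and> x = (\<Sum>i\<in>{i. f i \<noteq> 0}. f i)"
    using assms(2) by (intro conjI allI)
  have "\<exists>!f. finite {i. f i \<noteq> 0} \<and> (\<forall>i. f i \<in> G i) \<and> x = (\<Sum>i\<in>{i. f i \<noteq> 0}. f i)"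
    using graded unfolding graded_ring_def by (elim conjE allE)
  then show ?thesis unfolding hom_comp_def by (rule the1_equality) (rule f)
qed

lemma hom_comp_homogeneous: "x \<in> G d \<Longrightarrow> hom_comp x = (\<lambda>i. if i = d then x else 0)"
  by (rule hom_comp_eqI[of "{d}"]) (auto simp: G_zero)

lemma hom_comp_superset:
  assumes "finite A" "{i. hom_comp x i \<noteq> 0} \<subseteq> A"
  shows "(\<Sum>i\<in>A. hom_comp x i) = x"
proof -
  have "(\<Sum>i\<in>A. hom_comp x i) = (\<Sum>i\<in>{i. hom_comp x i \<noteq> 0}. hom_comp x i)"
    by (rule sum.mono_neutral_right[OF assms]) auto
  then show ?thesis by (simp add: hom_comp_sum)
qed

lemma hom_comp_add: "hom_comp (x + y) i = hom_comp x i + hom_comp y i"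
proof -
  let ?A = "{i. hom_comp x i \<noteq> 0} \<union> {i. hom_comp y i \<noteq> 0}"
  have f: "finite ?A" using finite_hom_comp by blast
  have "hom_comp (x + y) = (\<lambda>i. hom_comp x i + hom_comp y i)"
    by (rule hom_comp_eqI[OF f])
      (auto simp: sum.distrib hom_comp_superset[OF f] intro: G_add hom_comp_mem)
  then show ?thesis by simp
qed

lemma hom_comp_mult_homogeneous:
  assumes y: "y \<in> G d"
  shows "hom_comp (x * y) i = (if i < d then 0 else hom_comp x (i - d) * y)"
proof -
  let ?B = "{i. hom_comp x i \<noteq> 0}"
  let ?f = "\<lambda>i. if i < d then 0 else hom_comp x (i - d) * y"
  have "hom_comp (x * y) = ?f"
  proof (rule hom_comp_eqI[of "(\<lambda>i. i + d) ` ?B"])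
    show "finite ((\<lambda>i. i + d) ` ?B)" using finite_hom_comp by blast
    show "?f i \<in> G i" for i
      using G_mult[OF hom_comp_mem[of x "i - d"] y] by (auto simp: G_zero)
    show "?f i = 0" if "i \<notin> (\<lambda>i. i + d) ` ?B" for i
    proof (cases "i < d")
      case False
      then have "i = (i - d) + d" by simp
      then have "i - d \<notin> ?B" using that by blast
      then show ?thesis by simp
    qed simp
    have "(\<Sum>i\<in>(\<lambda>i. i + d) ` ?B. ?f i) = (\<Sum>i\<in>?B. hom_comp x i * y)"
      by (subst sum.reindex) (auto simp: inj_on_def)
    also have "\<dots> = x * y" by (simp add: hom_comp_sum flip: sum_distrib_right)
    finally show "x * y = (\<Sum>i\<in>(\<lambda>i. i + d) ` ?B. ?f i)" by simp
  qed
  then show ?thesis by simp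
qed

text \<open>Degrees such as \<open>\<alpha> + int k * int (card S)\<close> may be negative, so
  components are indexed by integers and set to \<open>0\<close> below degree zero, in agreement
  with \<open>hpiece\<close>.\<close>

definition int_comp :: "'a \<Rightarrow> int \<Rightarrow> 'a" where
  "int_comp x a = (if a < 0 then 0 else hom_comp x (nat a))"

lemma hpiece_zero: "0 \<in> hpiece G a"
  by (simp add: hpiece_def G_zero)

lemma hpiece_add: "x \<in> hpiece G a \<Longrightarrow> y \<in> hpiece G a \<Longrightarrow> x + y \<in> hpiece G a"
  by (auto simp: hpiece_def G_add split: if_splits)

lemma hpiece_uminus: "x \<in> hpiece G a \<Longrightarrow> - x \<in> hpiece G a"
  by (auto simp: hpiece_def G_uminus split: if_splits)

lemma hpiece_mult:
  assumes "x \<in> hpiece G a" "y \<in> hpiece G b" shows "x * y \<in> hpiece G (a + b)"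
proof (cases "a < 0 \<or> b < 0")
  case True
  then have "x * y = 0" using assms by (auto simp: hpiece_def)
  then show ?thesis by (simp add: hpiece_zero)
next
  case False
  then show ?thesis
    using assms G_mult[of x "nat a" y "nat b"] by (simp add: hpiece_def nat_add_distrib)
qed

lemma hpiece_sum: "(\<And>s. s \<in> A \<Longrightarrow> f s \<in> hpiece G a) \<Longrightarrow> sum f A \<in> hpiece G a"
  by (induction A rule: infinite_finite_induct) (auto simp: hpiece_zero hpiece_add)

lemma int_comp_mem: "int_comp x a \<in> hpiece G a"
  by (simp add: int_comp_def hpiece_def hom_comp_mem)

lemma int_comp_add: "int_comp (x + y) a = int_comp x a + int_comp y a"
  by (simp add: int_comp_def hom_comp_add)

lemma int_comp_zero: "int_comp 0 a = 0"
  using hom_comp_homogeneous[OF G_zero] by (auto simp: int_comp_def)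

lemma int_comp_diff: "int_comp (x - y) a = int_comp x a - int_comp y a"
  using int_comp_add[of "x - y" y a] by simp

lemma int_comp_uminus: "int_comp (- x) a = - int_comp x a"
  using int_comp_diff[of 0 x a] by (simp add: int_comp_zero)

lemma int_comp_sum: "int_comp (sum f A) a = (\<Sum>s\<in>A. int_comp (f s) a)"
  by (induction A rule: infinite_finite_induct) (auto simp: int_comp_zero int_comp_add)

lemma int_comp_hpiece: "x \<in> hpiece G a \<Longrightarrow> int_comp x a = x"
  by (auto simp: int_comp_def hpiece_def hom_comp_homogeneous split: if_splits)

text \<open>The case \<open>a < 0 \<le> a + e\<close> is included: both sides vanish there. This
  later shows that multiples of a degree-one element have no constant term.\<close>

lemma int_comp_mult_homogeneous:
  assumes "y \<in> hpiece G e" shows "int_comp (x * y) (a + e) = int_comp x a * y"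
proof (cases "e < 0")
  case True
  then show ?thesis using assms by (auto simp: hpiece_def int_comp_zero)
next
  case False
  then have y: "y \<in> G (nat e)" using assms by (simp add: hpiece_def)
  show ?thesis
    using False by (auto simp: int_comp_def hom_comp_mult_homogeneous[OF y] nat_diff_distrib[symmetric])
qed

definition hom_ideal :: "'a set \<Rightarrow> bool" where
  "hom_ideal I \<longleftrightarrow> is_ideal I \<and> (\<forall>x\<in>I. \<forall>a. int_comp x a \<in> I)"

end

section \<open>Ideals\<close>

lemma is_idealD:
  assumes "is_ideal I"
  shows ideal_zero: "0 \<in> I" and ideal_add: "x \<in> I \<Longrightarrow> y \<in> I \<Longrightarrow> x + y \<in> I"
    and ideal_mult: "x \<in> I \<Longrightarrow> r * x \<in> I"
  using assms unfolding is_ideal_def by blast+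

lemma ideal_mult_right: "is_ideal I \<Longrightarrow> x \<in> I \<Longrightarrow> x * r \<in> I"
  using ideal_mult[of I x r] by (simp add: mult.commute)

lemma ideal_uminus: "is_ideal I \<Longrightarrow> x \<in> I \<Longrightarrow> - x \<in> I"
  using ideal_mult[of I x "- 1"] by simp

lemma ideal_diff: "is_ideal I \<Longrightarrow> x \<in> I \<Longrightarrow> y \<in> I \<Longrightarrow> x - y \<in> I"
  using ideal_add[of I x "- y"] ideal_uminus[of I y] by simp

lemma ideal_sum: "is_ideal I \<Longrightarrow> (\<And>s. s \<in> A \<Longrightarrow> f s \<in> I) \<Longrightarrow> sum f A \<in> I"
  by (induction A rule: infinite_finite_induct) (auto intro: ideal_zero ideal_add)

lemma ideal_gen_subset: "is_ideal I \<Longrightarrow> S \<subseteq> I \<Longrightarrow> ideal_gen S \<subseteq> I"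
  unfolding ideal_gen_def by (auto intro!: ideal_sum ideal_mult)

text \<open>The union of an ascending chain is an ideal, and its finitely many generators already
  lie in one member, so the chain stops. The larger ideal comes first in the relation, so induction
  may assume a claim for all strictly larger ideals.\<close>

lemma wf_ideal_supset:
  assumes "noetherian TYPE('a::comm_ring_1)"
  shows "wf {(J, I :: 'a set). is_ideal I \<and> is_ideal J \<and> I \<subset> J}"
proof (unfold wf_iff_no_infinite_down_chain, rule notI, elim exE)
  fix f :: "nat \<Rightarrow> 'a set"
  assume "\<forall>i. (f (Suc i), f i) \<in> {(J, I). is_ideal I \<and> is_ideal J \<and> I \<subset> J}"
  then have id: "\<And>i. is_ideal (f i)" and strict: "\<And>i. f i \<subset> f (Suc i)" by auto
  have mono: "f i \<subseteq> f j" if "i \<le> j" for i j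
    by (rule lift_Suc_mono_le[of f, OF psubset_imp_subset[OF strict] that])
  let ?U = "\<Union>i. f i"
  have "is_ideal ?U"
    unfolding is_ideal_def
  proof (intro conjI ballI allI)
    show "0 \<in> ?U" using ideal_zero[OF id[of 0]] by blast
    fix x assume "x \<in> ?U"
    then obtain i where i: "x \<in> f i" by blast
    show "r * x \<in> ?U" for r using ideal_mult[OF id i, of r] by blast
    fix y assume "y \<in> ?U"
    then obtain j where j: "y \<in> f j" by blast
    have "x \<in> f (max i j)" "y \<in> f (max i j)"
      using i j mono[of i "max i j"] mono[of j "max i j"] by auto
    from ideal_add[OF id this] show "x + y \<in> ?U" by blast
  qed
  then obtain F where F: "finite F" "F \<subseteq> ?U" "?U = ideal_gen F"
    using assms unfolding noetherian_def by (elim allE[of _ ?U]) auto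
  have "\<exists>n. F \<subseteq> f n"
    using F(1,2)
  proof (induction F rule: finite_induct)
    case (insert x F)
    obtain n where "F \<subseteq> f n" using insert by auto
    moreover obtain i where "x \<in> f i" using insert.prems by auto
    ultimately have "insert x F \<subseteq> f (max n i)"
      using mono[of n "max n i"] mono[of i "max n i"] by auto
    then show ?case by blast
  qed simp
  then obtain n where "F \<subseteq> f n" by blast
  then have "?U \<subseteq> f n" unfolding F(3) by (rule ideal_gen_subset[OF id])
  then show False using strict[of n] by blast
qed

section \<open>Colon ideals and ideals with one element adjoined\<close>

definition ideal_colon :: "'a::comm_ring_1 set \<Rightarrow> 'a \<Rightarrow> 'a set" where
  "ideal_colon I x = {y. x * y \<in> I}"

definition ideal_adjoin :: "'a::comm_ring_1 set \<Rightarrow> 'a \<Rightarrow> 'a set" where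
  "ideal_adjoin I x = {u + x * y | u y. u \<in> I}"

lemma is_ideal_colon: "is_ideal I \<Longrightarrow> is_ideal (ideal_colon I x)"
  unfolding is_ideal_def ideal_colon_def
  by (auto simp: distrib_left mult.left_commute)

lemma ideal_adjoinI: "u \<in> I \<Longrightarrow> u + x * y \<in> ideal_adjoin I x"
  by (auto simp: ideal_adjoin_def)

lemma is_ideal_adjoin:
  assumes "is_ideal I" shows "is_ideal (ideal_adjoin I x)"
  unfolding is_ideal_def
proof (intro conjI ballI allI)
  show "0 \<in> ideal_adjoin I x"
    using ideal_adjoinI[OF ideal_zero[OF assms], of x 0] by simp
  fix a assume "a \<in> ideal_adjoin I x"
  then obtain u y where a: "u \<in> I" "a = u + x * y" by (auto simp: ideal_adjoin_def)
  show "r * a \<in> ideal_adjoin I x" for r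
    using ideal_adjoinI[OF ideal_mult[OF assms a(1)], of r x "r * y"]
    by (simp add: a(2) distrib_left mult.left_commute)
  fix b assume "b \<in> ideal_adjoin I x"
  then obtain v z where b: "v \<in> I" "b = v + x * z" by (auto simp: ideal_adjoin_def)
  show "a + b \<in> ideal_adjoin I x"
    using ideal_adjoinI[OF ideal_add[OF assms a(1) b(1)], of x "y + z"]
    by (simp add: a(2) b(2) distrib_left add_ac)
qed

lemma ideal_subset_colon: "is_ideal I \<Longrightarrow> I \<subseteq> ideal_colon I x"
  by (auto simp: ideal_colon_def ideal_mult)

lemma ideal_subset_adjoin: "I \<subseteq> ideal_adjoin I x"
  using ideal_adjoinI[of _ I x 0] by auto

lemma mem_ideal_adjoin: "is_ideal I \<Longrightarrow> x \<in> ideal_adjoin I x"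
  using ideal_adjoinI[OF ideal_zero, of I x 1] by simp

context graded_comm_ring
begin

text \<open>As \<open>x\<close> is homogeneous of degree \<open>d\<close>, the product
  \<open>x * int_comp y a\<close> is the component of \<open>x * y\<close> in degree
  \<open>a + d\<close>.\<close>

lemma hom_ideal_colon:
  assumes "hom_ideal I" "x \<in> hpiece G d"
  shows "hom_ideal (ideal_colon I x)"
proof -
  have "x * int_comp y a \<in> I" if "x * y \<in> I" for y a
  proof -
    have "int_comp (y * x) (a + d) = int_comp y a * x"
      by (rule int_comp_mult_homogeneous[OF assms(2)])
    moreover have "int_comp (x * y) (a + d) \<in> I" using assms(1) that by (simp add: hom_ideal_def)
    ultimately show ?thesis by (simp add: mult.commute)
  qed
  then show ?thesis using assms(1) is_ideal_colon by (auto simp: hom_ideal_def ideal_colon_def)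
qed

lemma hom_ideal_adjoin:
  assumes "hom_ideal I" "x \<in> hpiece G d"
  shows "hom_ideal (ideal_adjoin I x)"
proof -
  have "int_comp y a \<in> ideal_adjoin I x" if y: "y \<in> ideal_adjoin I x" for y a
  proof -
    from y obtain u z where u: "u \<in> I" "y = u + x * z" by (auto simp: ideal_adjoin_def)
    have "int_comp (z * x) (a - d + d) = int_comp z (a - d) * x"
      by (rule int_comp_mult_homogeneous[OF assms(2)])
    then have "int_comp y a = int_comp u a + x * int_comp z (a - d)"
      by (simp add: u(2) int_comp_add mult.commute)
    moreover have "int_comp u a \<in> I" using assms(1) u(1) by (simp add: hom_ideal_def)
    ultimately show ?thesis by (auto simp: ideal_adjoin_def)
  qed
  then show ?thesis using assms(1) is_ideal_adjoin by (auto simp: hom_ideal_def)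
qed

text \<open>Taking degree \<open>a\<close> components in \<open>y = u + x * z\<close> replaces the
  cofactor \<open>z\<close> by its component of degree \<open>a - d\<close>.\<close>

lemma ideal_adjoin_homogeneous_decomp:
  assumes "hom_ideal I" "x \<in> hpiece G d" "y \<in> ideal_adjoin I x" "y \<in> hpiece G a"
  shows "\<exists>e\<in>hpiece G (a - d). y - x * e \<in> I"
proof -
  from assms(3) obtain u z where u: "u \<in> I" "y = u + x * z" by (auto simp: ideal_adjoin_def)
  have "int_comp (z * x) (a - d + d) = int_comp z (a - d) * x"
    by (rule int_comp_mult_homogeneous[OF assms(2)])
  then have "int_comp y a = int_comp u a + x * int_comp z (a - d)"
    by (simp add: u(2) int_comp_add mult.commute)
  then have "y - x * int_comp z (a - d) = int_comp u a" using int_comp_hpiece[OF assms(4)] by simp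
  moreover have "int_comp u a \<in> I" using assms(1) u(1) by (simp add: hom_ideal_def)
  ultimately show ?thesis using int_comp_mem by (intro bexI[of _ "int_comp z (a - d)"]) auto
qed

end

section \<open>The Cech differential\<close>

lemma cech_d_add: "cech_d xs k (\<lambda>S. b S + c S) T = cech_d xs k b T + cech_d xs k c T"
  by (simp add: cech_d_def distrib_left distrib_right sum.distrib)

lemma cech_d_diff: "cech_d xs k (\<lambda>S. b S - c S) T = cech_d xs k b T - cech_d xs k c T"
  by (simp add: cech_d_def left_diff_distrib right_diff_distrib sum_subtractf)

lemma cech_d_scale: "cech_d xs k (\<lambda>S. r * c S) T = r * cech_d xs k c T"
  by (simp add: cech_d_def sum_distrib_left mult_ac)

lemma xprod_remove: "finite T \<Longrightarrow> s \<in> T \<Longrightarrow> xprod xs T = xs ! s * xprod xs (T - {s})"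
  unfolding xprod_def by (rule prod.remove)

text \<open>Rewriting the fraction \<open>c S / x_S^k\<close> as
  \<open>x_S^m c S / x_S^(k+m)\<close> commutes with the differential, because
  \<open>x_T = x_s x_(T - {s})\<close>.\<close>

lemma cech_d_shift:
  assumes "finite T"
  shows "cech_d xs (k + m) (\<lambda>S. xprod xs S ^ m * c S) T = xprod xs T ^ m * cech_d xs k c T"
  unfolding cech_d_def sum_distrib_left
proof (rule sum.cong[OF refl])
  fix s assume "s \<in> T"
  then show "csign T s * (xprod xs (T - {s}) ^ m * c (T - {s})) * xs ! s ^ (k + m) =
      xprod xs T ^ m * (csign T s * c (T - {s}) * xs ! s ^ k)"
    unfolding xprod_remove[OF assms \<open>s \<in> T\<close>]
    by (simp add: power_mult_distrib power_add mult_ac)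
qed

lemma cech_d_ideal:
  assumes "is_ideal I" "\<And>s. s \<in> T \<Longrightarrow> c (T - {s}) \<in> I" shows "cech_d xs k c T \<in> I"
  unfolding cech_d_def
  by (intro ideal_sum[OF assms(1)] ideal_mult_right[OF assms(1)] ideal_mult[OF assms(1)] assms(2))

text \<open>The sign counts the elements of \<open>T\<close> below \<open>s\<close>; this count
  drops by one exactly when the removed \<open>t\<close> lies below \<open>s\<close>.\<close>

lemma csign_remove:
  assumes "finite T" "t \<in> T"
  shows "(csign (T - {t}) s :: 'a::comm_ring_1) = (if t < s then - csign T s else csign T s)"
proof (cases "t < s")
  case True
  have eq: "{u \<in> T. u < s} = insert t {u \<in> T - {t}. u < s}" using True assms by auto
  have "card {u \<in> T. u < s} = Suc (card {u \<in> T - {t}. u < s})"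
    unfolding eq using assms(1) by (subst card_insert_disjoint) auto
  then show ?thesis using True by (simp add: csign_def)
next
  case False
  then have "{u \<in> T - {t}. u < s} = {u \<in> T. u < s}" by auto
  then show ?thesis using False by (simp add: csign_def)
qed

lemma csign_square: "(csign T s * csign T s :: 'a::comm_ring_1) = 1"
  by (simp add: csign_def flip: power_mult_distrib)

text \<open>Deleting two indices in either order leaves the same face with opposite signs. The
  double sum is split into \<open>s < t\<close> and \<open>t < s\<close>; after interchanging the
  sums, the second half is the negative of the first.\<close>

lemma cech_d_cech_d:
  assumes fin: "finite T"
  shows "cech_d xs k (cech_d xs k c) T = (0 :: 'a::comm_ring_1)"
proof -
  let ?g = "\<lambda>s t. csign T s * csign (T - {s}) t * c (T - {s} - {t}) * (xs ! s) ^ k * (xs ! t) ^ k"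
  have anti: "?g t s = - ?g s t" if "s \<in> T" "t \<in> T" "s < t" for s t
  proof -
    have "csign (T - {s}) t = - (csign T t :: 'a)" "csign (T - {t}) s = (csign T s :: 'a)"
      using csign_remove[OF fin that(1), of t, where ?'a = 'a]
        csign_remove[OF fin that(2), of s, where ?'a = 'a] that(3) by auto
    moreover have "T - {t} - {s} = T - {s} - {t}" by auto
    ultimately show ?thesis by (simp only: mult_ac mult_minus_left mult_minus_right minus_minus)
  qed
  have "cech_d xs k (cech_d xs k c) T = (\<Sum>s\<in>T. \<Sum>t\<in>T - {s}. ?g s t)"
    unfolding cech_d_def sum_distrib_left sum_distrib_right by (intro sum.cong refl) (simp add: mult_ac)
  also have "\<dots> = (\<Sum>s\<in>T. (\<Sum>t\<in>{t\<in>T. s < t}. ?g s t) + (\<Sum>t\<in>{t\<in>T. t < s}. ?g s t))"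
  proof (rule sum.cong[OF refl])
    fix s assume "s \<in> T"
    have eq: "T - {s} = {t\<in>T. s < t} \<union> {t\<in>T. t < s}" by auto
    show "(\<Sum>t\<in>T - {s}. ?g s t) = (\<Sum>t\<in>{t\<in>T. s < t}. ?g s t) + (\<Sum>t\<in>{t\<in>T. t < s}. ?g s t)"
      unfolding eq by (rule sum.union_disjoint) (use fin in auto)
  qed
  also have "\<dots> = (\<Sum>s\<in>T. \<Sum>t\<in>{t\<in>T. s < t}. ?g s t) + (\<Sum>s\<in>T. \<Sum>t\<in>{t\<in>T. t < s}. ?g s t)"
    by (rule sum.distrib)
  also have "(\<Sum>s\<in>T. \<Sum>t\<in>{t\<in>T. t < s}. ?g s t) = (\<Sum>t\<in>T. \<Sum>s\<in>{s\<in>T. t < s}. ?g s t)"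
    by (rule sum.swap_restrict[OF fin fin])
  also have "\<dots> = (\<Sum>t\<in>T. \<Sum>s\<in>{s\<in>T. t < s}. - ?g t s)"
    by (intro sum.cong refl, rule anti) simp_all
  finally show ?thesis unfolding sum_negf add.right_inverse .
qed

text \<open>For fixed \<open>k\<close> the numerators form the Koszul cochain complex on the
  elements \<open>(xs ! s) ^ k\<close>; this map is contraction in the direction of index
  \<open>j\<close>.\<close>

definition cech_homotopy :: "nat \<Rightarrow> (nat set \<Rightarrow> 'a::comm_ring_1) \<Rightarrow> nat set \<Rightarrow> 'a" where
  "cech_homotopy j c S = (if j \<in> S then 0 else csign S j * c (insert j S))"

text \<open>Multiplication by one of the Koszul elements is null-homotopic. If
  \<open>j \<in> S\<close>, only the face without \<open>j\<close> contributes. Otherwise the term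
  deleting \<open>j\<close> from \<open>insert j S\<close> gives the right-hand side and the other
  terms cancel in pairs.\<close>

lemma cech_homotopy:
  assumes fin: "finite S"
  shows "cech_d xs k (cech_homotopy j c) S + cech_homotopy j (cech_d xs k c) S =
         (xs ! j) ^ k * (c S :: 'a::comm_ring_1)"
proof (cases "j \<in> S")
  case True
  have "cech_d xs k (cech_homotopy j c) S =
    csign S j * cech_homotopy j c (S - {j}) * (xs ! j) ^ k +
    (\<Sum>s\<in>S - {j}. csign S s * cech_homotopy j c (S - {s}) * (xs ! s) ^ k)"
    unfolding cech_d_def by (rule sum.remove[OF fin True])
  also have "(\<Sum>s\<in>S - {j}. csign S s * cech_homotopy j c (S - {s}) * (xs ! s) ^ k) = 0"
    using True by (intro sum.neutral) (auto simp: cech_homotopy_def)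
  also have "csign S j * cech_homotopy j c (S - {j}) = csign S j * csign S j * c S"
    using True by (simp add: cech_homotopy_def insert_absorb csign_remove[OF fin True] mult.assoc)
  finally show ?thesis using True
    by (simp add: csign_square cech_homotopy_def[of j "cech_d xs k c"] mult.commute)
next
  case False
  let ?T = "insert j S"
  have finT: "finite ?T" using fin by simp
  have rem: "?T - {j} = S" using False by auto
  have sj: "csign ?T j = (csign S j :: 'a)"
    using csign_remove[OF finT, of j j, where ?'a = 'a] rem by simp
  have "cech_d xs k c ?T = csign ?T j * c S * (xs ! j) ^ k +
      (\<Sum>s\<in>S. csign ?T s * c (?T - {s}) * (xs ! s) ^ k)"
    unfolding cech_d_def by (subst sum.remove[OF finT, of j]) (simp_all add: rem)
  then have "cech_homotopy j (cech_d xs k c) S = csign S j * csign S j * c S * (xs ! j) ^ k +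
      (\<Sum>s\<in>S. csign S j * csign ?T s * c (?T - {s}) * (xs ! s) ^ k)"
    using False by (simp add: cech_homotopy_def sj distrib_left sum_distrib_left mult_ac)
  moreover have "cech_d xs k (cech_homotopy j c) S =
      (\<Sum>s\<in>S. - (csign S j * csign ?T s * c (?T - {s}) * (xs ! s) ^ k))"
    unfolding cech_d_def
  proof (rule sum.cong[OF refl])
    fix s assume s: "s \<in> S"
    then have sj: "s \<noteq> j" using False by auto
    have h: "cech_homotopy j c (S - {s}) = csign (S - {s}) j * c (?T - {s})"
      using False sj by (simp add: cech_homotopy_def insert_Diff_if)
    have 1: "(csign S s :: 'a) = (if j < s then - csign ?T s else csign ?T s)"
      using csign_remove[OF finT, of j s, where ?'a = 'a] rem by simp
    have 2: "(csign (S - {s}) j :: 'a) = (if s < j then - csign S j else csign S j)"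
      by (rule csign_remove[OF fin s])
    have "csign S s * csign (S - {s}) j = - (csign S j * csign ?T s :: 'a)"
      unfolding 1 2 using sj by (auto simp: mult_ac)
    then show "csign S s * cech_homotopy j c (S - {s}) * (xs ! s) ^ k =
      - (csign S j * csign ?T s * c (?T - {s}) * (xs ! s) ^ k)"
      unfolding h by (simp flip: mult.assoc)
  qed
  ultimately show ?thesis by (simp add: csign_square sum_negf mult.commute)
qed

section \<open>Vanishing in large degrees\<close>

locale standard_graded_ring = graded_comm_ring G for G :: "nat \<Rightarrow> 'a::comm_ring_1 set" +
  fixes xs :: "'a list"
  assumes standard: "standard_graded G" and spans: "spans_deg1 G xs"
begin

section \<open>Degrees of products, signs and cochains\<close>

lemma one_mem: "1 \<in> G 0"
  using standard by (simp add: standard_graded_def degree0_field_def)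

lemma hpiece_power: "x \<in> hpiece G a \<Longrightarrow> x ^ n \<in> hpiece G (int n * a)"
proof (induction n)
  case 0
  then show ?case by (simp add: hpiece_def one_mem)
next
  case (Suc n)
  then have "x * x ^ n \<in> hpiece G (a + int n * a)" by (intro hpiece_mult) auto
  then show ?case by (simp add: algebra_simps)
qed

lemma xs_mem: "j < length xs \<Longrightarrow> xs ! j \<in> hpiece G 1"
  using spans by (auto simp: spans_deg1_def hpiece_def)

lemma xprod_mem: "S \<subseteq> {..<length xs} \<Longrightarrow> xprod xs S \<in> hpiece G (int (card S))"
proof (induction S rule: infinite_finite_induct)
  case (infinite S)
  then show ?case using finite_subset by blast
next
  case empty
  then show ?case by (simp add: xprod_def hpiece_def one_mem)
next
  case (insert s S)
  then have "xs ! s * xprod xs S \<in> hpiece G (1 + int (card S))"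
    by (intro hpiece_mult xs_mem) auto
  then show ?case using insert.hyps by (simp add: xprod_def)
qed

lemma csign_mult_mem: "x \<in> hpiece G a \<Longrightarrow> csign T s * x \<in> hpiece G a"
  by (cases "even (card {t \<in> T. t < s})") (simp_all add: csign_def hpiece_uminus)

text \<open>Values on all index sets are kept, so that all cohomological degrees are carried
  together. The fraction \<open>c S / x_S^k\<close> has degree \<open>\<alpha>\<close>, since
  \<open>x_S\<close> has degree \<open>card S\<close>.\<close>

definition cochain :: "int \<Rightarrow> nat \<Rightarrow> (nat set \<Rightarrow> 'a) \<Rightarrow> bool" where
  "cochain \<alpha> k c \<longleftrightarrow> (\<forall>S\<subseteq>{..<length xs}. c S \<in> hpiece G (\<alpha> + int k * int (card S)))"

lemma cochain_add: "cochain \<alpha> k b \<Longrightarrow> cochain \<alpha> k c \<Longrightarrow> cochain \<alpha> k (\<lambda>S. b S + c S)"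
  by (simp add: cochain_def hpiece_add)

lemma cochain_diff: "cochain \<alpha> k b \<Longrightarrow> cochain \<alpha> k c \<Longrightarrow> cochain \<alpha> k (\<lambda>S. b S - c S)"
  using hpiece_add[OF _ hpiece_uminus] by (simp add: cochain_def)

lemma cochain_mult:
  assumes "y \<in> hpiece G d" "cochain \<alpha> k c" shows "cochain (\<alpha> + d) k (\<lambda>S. y * c S)"
  unfolding cochain_def
proof (intro allI impI)
  fix S assume "S \<subseteq> {..<length xs}"
  then have "y * c S \<in> hpiece G (d + (\<alpha> + int k * int (card S)))"
    using assms by (intro hpiece_mult) (auto simp: cochain_def)
  then show "y * c S \<in> hpiece G (\<alpha> + d + int k * int (card S))" by (simp add: algebra_simps)
qed

lemma cochain_shift:
  assumes "cochain \<alpha> k c" shows "cochain \<alpha> (k + m) (\<lambda>S. xprod xs S ^ m * c S)"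
  unfolding cochain_def
proof (intro allI impI)
  fix S assume "S \<subseteq> {..<length xs}"
  then have "xprod xs S ^ m * c S \<in> hpiece G (int m * int (card S) + (\<alpha> + int k * int (card S)))"
    using assms by (intro hpiece_mult hpiece_power xprod_mem) (auto simp: cochain_def)
  then show "xprod xs S ^ m * c S \<in> hpiece G (\<alpha> + int (k + m) * int (card S))"
    by (simp add: algebra_simps)
qed

lemma cochain_cech_d:
  assumes "cochain \<alpha> k c" shows "cochain \<alpha> k (cech_d xs k c)"
  unfolding cochain_def cech_d_def
proof (intro allI impI hpiece_sum)
  fix T s assume T: "T \<subseteq> {..<length xs}" "s \<in> T"
  have "finite T" using T(1) finite_subset by blast
  from card_Suc_Diff1[OF this T(2)] have card: "int (card T) = int (card (T - {s})) + 1"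
    by linarith
  have "csign T s * c (T - {s}) * xs ! s ^ k \<in>
      hpiece G ((\<alpha> + int k * int (card (T - {s}))) + int k * 1)"
    using assms[unfolded cochain_def, rule_format, of "T - {s}"] T
    by (intro hpiece_mult[OF csign_mult_mem] hpiece_power xs_mem) auto
  then show "csign T s * c (T - {s}) * xs ! s ^ k \<in> hpiece G (\<alpha> + int k * int (card T))"
    unfolding card by (simp add: algebra_simps)
qed

text \<open>The degree rises by \<open>k\<close> because the value on \<open>S\<close> is taken from
  \<open>insert j S\<close>, which has one index more.\<close>

lemma cochain_homotopy:
  assumes "cochain \<alpha> k c" "j < length xs" shows "cochain (\<alpha> + int k) k (cech_homotopy j c)"
  unfolding cochain_def
proof (intro allI impI)
  fix S assume S: "S \<subseteq> {..<length xs}"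
  then have "finite S" using finite_subset by blast
  moreover have "c (insert j S) \<in> hpiece G (\<alpha> + int k * int (card (insert j S)))"
    using S assms by (simp add: cochain_def)
  ultimately show "cech_homotopy j c S \<in> hpiece G (\<alpha> + int k + int k * int (card S))"
    by (cases "j \<in> S") (simp_all add: cech_homotopy_def hpiece_zero csign_mult_mem algebra_simps)
qed

text \<open>All cohomological degrees are treated at once: this says that the degree \<open>\<alpha>\<close> part of the
  Cech cohomology of \<open>R/I\<close> is zero. Raising the common denominator exponent \<open>k\<close> lets the localizations
  at \<open>x\<^sub>S\<close> be replaced by membership in \<open>I\<close>.\<close>

definition cech_vanishes :: "'a set \<Rightarrow> int \<Rightarrow> bool" where
  "cech_vanishes I \<alpha> \<longleftrightarrow> (\<forall>k c. cochain \<alpha> k c \<and> (\<forall>T\<subseteq>{..<length xs}. cech_d xs k c T \<in> I) \<longrightarrow>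
     (\<exists>m b. cochain \<alpha> (k + m) b \<and>
        (\<forall>S\<subseteq>{..<length xs}. xprod xs S ^ m * c S - cech_d xs (k + m) b S \<in> I)))"

lemma cech_vanishesD:
  assumes "cech_vanishes I \<alpha>" "cochain \<alpha> k c" "\<And>T. T \<subseteq> {..<length xs} \<Longrightarrow> cech_d xs k c T \<in> I"
  obtains m b where "cochain \<alpha> (k + m) b"
    "\<And>S. S \<subseteq> {..<length xs} \<Longrightarrow> xprod xs S ^ m * c S - cech_d xs (k + m) b S \<in> I"
  using assms unfolding cech_vanishes_def by blast

lemma finite_idx: "S \<subseteq> {..<length xs} \<Longrightarrow> finite S"
  using finite_subset by blast

text \<open>The cofactors of \<open>xs ! j\<close> are chosen separately for each index set; their
  degree is one lower because \<open>xs ! j\<close> has degree one.\<close>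

lemma lift_cochain_adjoin:
  assumes I: "hom_ideal I" and j: "j < length xs" and c: "cochain \<alpha> k c"
    and mem: "\<And>S. S \<subseteq> {..<length xs} \<Longrightarrow> c S \<in> ideal_adjoin I (xs ! j)"
  obtains e where "cochain (\<alpha> - 1) k e"
    "\<And>S. S \<subseteq> {..<length xs} \<Longrightarrow> c S - xs ! j * e S \<in> I"
proof -
  have "\<exists>e. e \<in> hpiece G (\<alpha> + int k * int (card S) - 1) \<and> c S - xs ! j * e \<in> I"
    if "S \<subseteq> {..<length xs}" for S
    using ideal_adjoin_homogeneous_decomp[OF I xs_mem[OF j] mem[OF that]] c that
    unfolding cochain_def by blast
  then obtain e where "\<And>S. S \<subseteq> {..<length xs} \<Longrightarrow>
      e S \<in> hpiece G (\<alpha> + int k * int (card S) - 1) \<and> c S - xs ! j * e S \<in> I"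
    by metis
  then show ?thesis by (intro that[of e]) (auto simp: cochain_def algebra_simps)
qed

text \<open>A diagram chase along \<open>0 -> R/(I : x)(-1) -> R/I -> R/(I + (x)) -> 0\<close>,
  carried out on representatives. The given cocycle bounds modulo \<open>I + (x)\<close>; the error
  is \<open>x\<close> times a cocycle modulo \<open>I : x\<close>, which bounds in degree
  \<open>\<alpha> - 1\<close>.\<close>

lemma cech_vanishes_extension:
  assumes I: "hom_ideal I" and j: "j < length xs"
    and colon: "cech_vanishes (ideal_colon I (xs ! j)) (\<alpha> - 1)"
    and adjoin: "cech_vanishes (ideal_adjoin I (xs ! j)) \<alpha>"
  shows "cech_vanishes I \<alpha>"
  unfolding cech_vanishes_def
proof (intro allI impI, elim conjE)
  fix k c assume c: "cochain \<alpha> k c" and dc: "\<forall>T\<subseteq>{..<length xs}. cech_d xs k c T \<in> I"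
  have id: "is_ideal I" using I by (simp add: hom_ideal_def)
  let ?x = "xs ! j"
  have "cech_d xs k c T \<in> ideal_adjoin I ?x" if "T \<subseteq> {..<length xs}" for T
    using dc that by (intro subsetD[OF ideal_subset_adjoin]) simp
  from cech_vanishesD[OF adjoin c this] obtain m b where b: "cochain \<alpha> (k + m) b"
    "\<And>S. S \<subseteq> {..<length xs} \<Longrightarrow> xprod xs S ^ m * c S - cech_d xs (k + m) b S \<in> ideal_adjoin I ?x"
    by metis
  obtain e where e: "cochain (\<alpha> - 1) (k + m) e" "\<And>S. S \<subseteq> {..<length xs} \<Longrightarrow>
      (xprod xs S ^ m * c S - cech_d xs (k + m) b S) - ?x * e S \<in> I"
    using lift_cochain_adjoin[OF I j cochain_diff[OF cochain_shift[OF c] cochain_cech_d[OF b(1)]] b(2)]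
    by metis
  \<comment> \<open>The differential is applied to the congruence that defines \<open>e\<close>. The
    contribution of \<open>b\<close> vanishes and that of \<open>c\<close> lies in \<open>I\<close>,
    so \<open>?x\<close> times the differential of \<open>e\<close> lies in
    \<open>I\<close>.\<close>
  have "cech_d xs (k + m) e T \<in> ideal_colon I ?x" if T: "T \<subseteq> {..<length xs}" for T
  proof -
    have "cech_d xs (k + m)
        (\<lambda>S. (xprod xs S ^ m * c S - cech_d xs (k + m) b S) - ?x * e S) T \<in> I"
      by (rule cech_d_ideal[OF id], rule e(2)) (use T in auto)
    then have "xprod xs T ^ m * cech_d xs k c T - ?x * cech_d xs (k + m) e T \<in> I"
      by (simp add: cech_d_diff cech_d_scale cech_d_shift cech_d_cech_d finite_idx[OF T])
    moreover have "xprod xs T ^ m * cech_d xs k c T \<in> I" using dc T by (simp add: ideal_mult[OF id])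
    ultimately have "?x * cech_d xs (k + m) e T \<in> I" using ideal_diff[OF id] by fastforce
    then show ?thesis by (simp add: ideal_colon_def)
  qed
  from cech_vanishesD[OF colon e(1) this] obtain m' b' where b':
    "cochain (\<alpha> - 1) (k + m + m') b'" "\<And>S. S \<subseteq> {..<length xs} \<Longrightarrow>
      xprod xs S ^ m' * e S - cech_d xs (k + m + m') b' S \<in> ideal_colon I ?x"
    by metis
  \<comment> \<open>Both corrections are combined: \<open>b\<close>, brought to the exponent
    \<open>k + m + m'\<close>, and \<open>?x\<close> times the cochain that bounds
    \<open>e\<close>.\<close>
  let ?b = "\<lambda>S. xprod xs S ^ m' * b S + ?x * b' S"
  have "cochain \<alpha> (k + m + m') ?b"
    using cochain_add[OF cochain_shift[OF b(1), of m'] cochain_mult[OF xs_mem[OF j] b'(1), simplified]]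
    by simp
  moreover have "xprod xs S ^ (m + m') * c S - cech_d xs (k + m + m') ?b S \<in> I"
    if S: "S \<subseteq> {..<length xs}" for S
  proof -
    have "xprod xs S ^ m' * ((xprod xs S ^ m * c S - cech_d xs (k + m) b S) - ?x * e S) +
       ?x * (xprod xs S ^ m' * e S - cech_d xs (k + m + m') b' S) \<in> I"
      using b'(2)[OF S, unfolded ideal_colon_def]
      by (intro ideal_add[OF id ideal_mult[OF id e(2)[OF S]]]) simp
    moreover have "cech_d xs (k + m + m') ?b S =
        xprod xs S ^ m' * cech_d xs (k + m) b S + ?x * cech_d xs (k + m + m') b' S"
      by (simp add: cech_d_add cech_d_scale cech_d_shift finite_idx[OF S])
    ultimately show ?thesis by (simp add: power_add algebra_simps)
  qed
  ultimately show "\<exists>m b. cochain \<alpha> (k + m) b \<and>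
      (\<forall>S\<subseteq>{..<length xs}. xprod xs S ^ m * c S - cech_d xs (k + m) b S \<in> I)"
    by (intro exI[of _ "m + m'"] exI[of _ ?b]) (simp add: add.assoc)
qed

text \<open>Vanishing for \<open>I + (x)\<close> in degree \<open>\<alpha> + 1\<close> makes
  multiplication by the regular element \<open>x\<close> injective on cohomology of
  \<open>R/I\<close> from degree \<open>\<alpha>\<close> to \<open>\<alpha> + 1\<close>. Hence
  \<open>c\<close> bounds once some \<open>x^n c\<close> does, and the Koszul homotopy supplies this
  for \<open>n = k\<close>.\<close>

lemma cech_vanishes_regular:
  assumes I: "hom_ideal I" and j: "j < length xs"
    and colon: "ideal_colon I (xs ! j) = I"
    and adjoin: "\<And>\<alpha>. \<alpha> > D \<Longrightarrow> cech_vanishes (ideal_adjoin I (xs ! j)) \<alpha>"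
    and \<alpha>: "\<alpha> > D"
  shows "cech_vanishes I \<alpha>"
  unfolding cech_vanishes_def
proof (intro allI impI, elim conjE)
  fix k c assume c: "cochain \<alpha> k c" and dc: "\<forall>T\<subseteq>{..<length xs}. cech_d xs k c T \<in> I"
  have id: "is_ideal I" using I by (simp add: hom_ideal_def)
  let ?x = "xs ! j"
  let ?P = "\<lambda>\<alpha> c. \<exists>m b. cochain \<alpha> (k + m) b \<and>
      (\<forall>S\<subseteq>{..<length xs}. xprod xs S ^ m * c S - cech_d xs (k + m) b S \<in> I)"
  \<comment> \<open>If \<open>?x * c\<close> is, after raising exponents, the differential of
    \<open>b\<close> modulo \<open>I\<close>, then \<open>b\<close> is a cocycle modulo
    \<open>I + (x)\<close>. So \<open>b\<close> is a coboundary plus \<open>?x * e\<close> modulo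
    \<open>I\<close>. Taking differentials and cancelling \<open>?x\<close>, which
    \<open>colon\<close> permits, shows that \<open>e\<close> bounds \<open>c\<close>.\<close>
  have step: "?P \<alpha> c" if \<alpha>: "\<alpha> > D" and "?P (\<alpha> + 1) (\<lambda>S. ?x * c S)" for \<alpha> c
  proof -
    from that(2) obtain m b where b: "cochain (\<alpha> + 1) (k + m) b" "\<And>S. S \<subseteq> {..<length xs} \<Longrightarrow>
        xprod xs S ^ m * (?x * c S) - cech_d xs (k + m) b S \<in> I" by blast
    have "cech_d xs (k + m) b T \<in> ideal_adjoin I ?x" if T: "T \<subseteq> {..<length xs}" for T
      using ideal_adjoinI[OF ideal_uminus[OF id b(2)[OF T]], of ?x "xprod xs T ^ m * c T"]
      by (simp add: algebra_simps)
    from cech_vanishesD[OF adjoin b(1) this] \<alpha> obtain m' b' where b': "cochain (\<alpha> + 1) (k + m + m') b'" "\<And>S. S \<subseteq> {..<length xs} \<Longrightarrow>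
        xprod xs S ^ m' * b S - cech_d xs (k + m + m') b' S \<in> ideal_adjoin I ?x"
      by (metis less_add_one order_less_trans)
    obtain e where e: "cochain \<alpha> (k + m + m') e" "\<And>S. S \<subseteq> {..<length xs} \<Longrightarrow>
        (xprod xs S ^ m' * b S - cech_d xs (k + m + m') b' S) - ?x * e S \<in> I"
      using lift_cochain_adjoin[OF I j
          cochain_diff[OF cochain_shift[OF b(1)] cochain_cech_d[OF b'(1)]] b'(2)]
      by (metis add_diff_cancel_right')
    have "xprod xs S ^ (m + m') * c S - cech_d xs (k + m + m') e S \<in> I"
      if S: "S \<subseteq> {..<length xs}" for S
    proof -
      have "cech_d xs (k + m + m')
          (\<lambda>S. (xprod xs S ^ m' * b S - cech_d xs (k + m + m') b' S) - ?x * e S) S \<in> I"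
        by (rule cech_d_ideal[OF id], rule e(2)) (use S in auto)
      then have "xprod xs S ^ m' * cech_d xs (k + m) b S - ?x * cech_d xs (k + m + m') e S \<in> I"
        by (simp add: cech_d_diff cech_d_scale cech_d_shift cech_d_cech_d finite_idx[OF S])
      from ideal_add[OF id this ideal_mult[OF id b(2)[OF S], of "xprod xs S ^ m'"]]
      have "?x * (xprod xs S ^ (m + m') * c S - cech_d xs (k + m + m') e S) \<in> I"
        by (simp add: power_add algebra_simps)
      then have "xprod xs S ^ (m + m') * c S - cech_d xs (k + m + m') e S \<in> ideal_colon I ?x"
        by (simp add: ideal_colon_def)
      then show ?thesis by (simp only: colon)
    qed
    then show ?thesis
      using e(1) by (intro exI[of _ "m + m'"] exI[of _ e]) (simp add: add.assoc)
  qed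
  have descend: "?P (\<alpha> + int n) (\<lambda>S. ?x ^ n * c S) \<Longrightarrow> ?P \<alpha> c" for n
  proof (induction n)
    case (Suc n)
    have "?P (\<alpha> + int n) (\<lambda>S. ?x ^ n * c S)"
    proof (rule step)
      show "\<alpha> + int n > D" using \<alpha> by simp
      show "?P (\<alpha> + int n + 1) (\<lambda>S. ?x * (?x ^ n * c S))"
        using Suc.prems by (simp add: ac_simps)
    qed
    then show ?case by (rule Suc.IH)
  qed simp
  \<comment> \<open>The power is the denominator exponent \<open>k\<close> because the homotopy
    formula is for multiplication by exactly \<open>?x ^ k\<close>. Its second term lies in
    \<open>I\<close>, since the differential of \<open>c\<close> does.\<close>
  have "?P (\<alpha> + int k) (\<lambda>S. ?x ^ k * c S)"
  proof (intro exI[of _ 0] exI[of _ "cech_homotopy j c"] conjI allI impI)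
    show "cochain (\<alpha> + int k) (k + 0) (cech_homotopy j c)" using cochain_homotopy[OF c j] by simp
    fix S assume S: "S \<subseteq> {..<length xs}"
    have "cech_homotopy j (cech_d xs k c) S \<in> I"
      using dc S j by (auto simp: cech_homotopy_def ideal_zero[OF id] ideal_mult[OF id])
    then show "xprod xs S ^ 0 * (?x ^ k * c S) - cech_d xs (k + 0) (cech_homotopy j c) S \<in> I"
      using cech_homotopy[OF finite_idx[OF S], of xs k j c, symmetric] by simp
  qed
  then show "?P \<alpha> c" by (rule descend)
qed

text \<open>Generation in degree one makes every element a constant plus a combination of
  \<open>xs\<close> with coefficients in the ring. The constant is the degree-zero component, which
  vanishes for \<open>y\<close>.\<close>

lemma positive_degree_subset:
  assumes I: "is_ideal I" and xsI: "set xs \<subseteq> I" and d: "d > 0" and y: "y \<in> G d"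
  shows "y \<in> I"
proof -
  let ?lin = "\<lambda>r. \<Sum>j<length xs. r j * xs ! j"
  have gen: "\<exists>a r. a \<in> G 0 \<and> z = a + ?lin r" if "z \<in> gen_alg G" for z
    using that
  proof induction
    case (base0 z)
    then show ?case by (intro exI[of _ z] exI[of _ "\<lambda>_. 0"]) simp
  next
    case (base1 z)
    then obtain r where "z = ?lin r" using spans unfolding spans_deg1_def by blast
    then show ?case by (intro exI[of _ 0] exI[of _ r]) (simp add: G_zero)
  next
    case (add z w)
    then obtain a r b t where "a \<in> G 0" "z = a + ?lin r" "b \<in> G 0" "w = b + ?lin t" by blast
    then show ?case
      by (intro exI[of _ "a + b"] exI[of _ "\<lambda>j. r j + t j"])
        (simp add: G_add distrib_right sum.distrib)
  next
    case (neg z)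
    then obtain a r where "a \<in> G 0" "z = a + ?lin r" by blast
    then show ?case
      by (intro exI[of _ "- a"] exI[of _ "\<lambda>j. - r j"]) (simp add: G_uminus sum_negf)
  next
    case (mult z w)
    then obtain a r b t where ab: "a \<in> G 0" "z = a + ?lin r" "b \<in> G 0" "w = b + ?lin t" by blast
    \<comment> \<open>These coefficients come from \<open>z * w = a * w + ?lin r * w\<close>, where
      \<open>w\<close> is expanded in the first summand only.\<close>
    have "?lin (\<lambda>j. a * t j + w * r j) = a * ?lin t + w * ?lin r"
      by (simp add: distrib_right sum.distrib sum_distrib_left mult.assoc)
    then have "z * w = a * b + ?lin (\<lambda>j. a * t j + w * r j)"
      unfolding ab(2,4) by (simp add: algebra_simps)
    then show ?case using G_mult[OF ab(1,3)]
      by (intro exI[of _ "a * b"] exI[of _ "\<lambda>j. a * t j + w * r j"]) simp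
  qed
  have "y \<in> gen_alg G" using standard by (simp add: standard_graded_def)
  from gen[OF this] obtain a r where a: "a \<in> G 0" and yr: "y = a + ?lin r" by blast
  \<comment> \<open>With \<open>0\<close> read as \<open>- 1 + 1\<close>, this is the component of
    \<open>r j\<close> in degree \<open>- 1\<close> times \<open>xs ! j\<close>.\<close>
  have "int_comp (r j * xs ! j) 0 = 0" if "j < length xs" for j
    using int_comp_mult_homogeneous[OF xs_mem[OF that], of "r j" "- 1"] by (simp add: int_comp_def)
  then have "int_comp y 0 = int_comp a 0" by (simp add: yr int_comp_add int_comp_sum)
  also have "\<dots> = a" using a by (intro int_comp_hpiece) (simp add: hpiece_def)
  finally have "a = 0" using d by (simp add: int_comp_def hom_comp_homogeneous[OF y])
  then have "y = ?lin r" using yr by simp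
  also have "\<dots> \<in> I" using xsI by (intro ideal_sum[OF I] ideal_mult[OF I]) auto
  finally show ?thesis .
qed

lemma cech_vanishes_large_degree:
  assumes "hom_ideal I"
  shows "\<exists>D. \<forall>\<alpha>>D. cech_vanishes I \<alpha>"
proof -
  have "noetherian TYPE('a)" using standard by (simp add: standard_graded_def)
  from wf_ideal_supset[OF this] show ?thesis using assms
  proof (induction I rule: wf_induct_rule)
    case (less I)
    note I = less.prems
    then have id: "is_ideal I" by (simp add: hom_ideal_def)
    show ?case
    proof (cases "set xs \<subseteq> I")
      case True
      have "cech_vanishes I \<alpha>" if \<alpha>: "\<alpha> > 0" for \<alpha>
        unfolding cech_vanishes_def
      proof (intro allI impI, elim conjE)
        fix k c assume c: "cochain \<alpha> k c"
        \<comment> \<open>One extra factor and the zero cochain suffice: for nonempty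
          \<open>S\<close> the factor \<open>xprod xs S\<close> lies in \<open>I\<close>, and
          \<open>c {}\<close> has positive degree \<open>\<alpha>\<close>.\<close>
        have "xprod xs S ^ 1 * c S - cech_d xs (k + 1) (\<lambda>_. 0) S \<in> I"
          if S: "S \<subseteq> {..<length xs}" for S
        proof (cases "S = {}")
          case empty: True
          have "c {} \<in> hpiece G \<alpha>" using c[unfolded cochain_def, rule_format, of "{}"] by simp
          then have "c {} \<in> I"
            using positive_degree_subset[OF id True, of "nat \<alpha>"] \<alpha> by (simp add: hpiece_def)
          then show ?thesis by (simp add: empty cech_d_def xprod_def)
        next
          case False
          then obtain s where s: "s \<in> S" by blast
          then have "xs ! s \<in> I" using S True by (auto dest: nth_mem)
          then have "xprod xs S \<in> I"
            using xprod_remove[OF finite_idx[OF S] s, of xs] ideal_mult_right[OF id] by simp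
          then show ?thesis using ideal_mult_right[OF id] by (simp add: cech_d_def)
        qed
        moreover have "cochain \<alpha> (k + 1) (\<lambda>_. 0)" by (simp add: cochain_def hpiece_zero)
        ultimately show "\<exists>m b. cochain \<alpha> (k + m) b \<and>
            (\<forall>S\<subseteq>{..<length xs}. xprod xs S ^ m * c S - cech_d xs (k + m) b S \<in> I)"
          by blast
      qed
      then show ?thesis by blast
    next
      case False
      then obtain j where j: "j < length xs" "xs ! j \<notin> I" by (metis in_set_conv_nth subsetI)
      let ?x = "xs ! j"
      have adj: "hom_ideal (ideal_adjoin I ?x)" by (rule hom_ideal_adjoin[OF I xs_mem[OF j(1)]])
      have "I \<subset> ideal_adjoin I ?x"
        using ideal_subset_adjoin[of I ?x] mem_ideal_adjoin[OF id, of ?x] j(2) by auto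
      then obtain D1 where D1: "\<And>\<alpha>. \<alpha> > D1 \<Longrightarrow> cech_vanishes (ideal_adjoin I ?x) \<alpha>"
        using less.IH[of "ideal_adjoin I ?x"] adj id by (auto simp: hom_ideal_def)
      show ?thesis
      proof (cases "ideal_colon I ?x = I")
        case True
        then show ?thesis using cech_vanishes_regular[OF I j(1) True D1] by blast
      next
        case False
        have col: "hom_ideal (ideal_colon I ?x)" by (rule hom_ideal_colon[OF I xs_mem[OF j(1)]])
        have "I \<subset> ideal_colon I ?x" using False ideal_subset_colon[OF id, of ?x] by auto
        then obtain D2 where D2: "\<And>\<alpha>. \<alpha> > D2 \<Longrightarrow> cech_vanishes (ideal_colon I ?x) \<alpha>"
          using less.IH[of "ideal_colon I ?x"] col id by (auto simp: hom_ideal_def)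
        \<comment> \<open>The bound \<open>D2 + 1\<close> appears because the colon ideal enters in
          degree \<open>\<alpha> - 1\<close>.\<close>
        have "cech_vanishes I \<alpha>" if "\<alpha> > max D1 (D2 + 1)" for \<alpha>
          using that by (intro cech_vanishes_extension[OF I j(1) D2 D1]) auto
        then show ?thesis by blast
      qed
    qed
  qed
qed

end

section \<open>Descent along Frobenius splittings\<close>

context graded_comm_ring
begin

lemma hom_comp_zero: "hom_comp 0 i = 0"
  using hom_comp_homogeneous[OF G_zero] by simp

lemma hom_comp_sum_distrib: "hom_comp (sum f A) i = (\<Sum>s\<in>A. hom_comp (f s) i)"
  by (induction A rule: infinite_finite_induct) (auto simp: hom_comp_zero hom_comp_add)

lemma hom_comp_mult:
  "hom_comp (x * y) i =
     (\<Sum>j\<in>{j. hom_comp y j \<noteq> 0}. if i < j then 0 else hom_comp x (i - j) * hom_comp y j)"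
proof -
  have "x * y = (\<Sum>j\<in>{j. hom_comp y j \<noteq> 0}. x * hom_comp y j)"
    by (simp add: hom_comp_sum flip: sum_distrib_left)
  then have "hom_comp (x * y) i = (\<Sum>j\<in>{j. hom_comp y j \<noteq> 0}. hom_comp (x * hom_comp y j) i)"
    by (simp only: hom_comp_sum_distrib)
  then show ?thesis by (simp only: hom_comp_mult_homogeneous[OF hom_comp_mem])
qed

lemma irrel_ideal_hom_comp: "x \<in> irrel_ideal G \<Longrightarrow> hom_comp x 0 = 0"
proof -
  assume "x \<in> irrel_ideal G"
  then obtain f where f: "finite {i. f i \<noteq> 0}" "\<And>i. f i \<in> G i" "f 0 = 0" "x = (\<Sum>i\<in>{i. f i \<noteq> 0}. f i)"
    unfolding irrel_ideal_def by blast
  have "hom_comp x = f" by (rule hom_comp_eqI[OF f(1,2) _ f(4)]) simp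
  then show ?thesis using f(3) by simp
qed

text \<open>Degrees add up: a factor from the irrelevant ideal has no constant term, and a factor
  from the \<open>N\<close>-th power starts in degree \<open>N\<close>. Ring coefficients cannot
  lower degrees.\<close>

lemma irrel_pow_hom_comp: "x \<in> ideal_pow (irrel_ideal G) N \<Longrightarrow> i < N \<Longrightarrow> hom_comp x i = 0"
proof (induction N arbitrary: x i)
  case (Suc N)
  then obtain F r where F: "F \<subseteq> {a * b | a b. a \<in> irrel_ideal G \<and> b \<in> ideal_pow (irrel_ideal G) N}"
    "x = (\<Sum>s\<in>F. r s * s)"
    by (auto simp: ideal_gen_def)
  have prod0: "hom_comp s l = 0" if s: "s \<in> F" and l: "l < Suc N" for s l
  proof -
    obtain a b where ab: "s = a * b" "a \<in> irrel_ideal G" "b \<in> ideal_pow (irrel_ideal G) N"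
      using F(1) s by blast
    have "hom_comp a (l - j) = 0" if "\<not> l < j" "hom_comp b j \<noteq> 0" for j
    proof -
      have "\<not> j < N" using Suc.IH[OF ab(3)] that(2) by blast
      \<comment> \<open>From \<open>N \<le> j \<le> l < Suc N\<close> only \<open>j = l = N\<close>
        remains, which pairs with the constant term of \<open>a\<close>.\<close>
      then have "l - j = 0" using l that(1) by simp
      then show ?thesis using irrel_ideal_hom_comp[OF ab(2)] by simp
    qed
    then show ?thesis unfolding ab(1) hom_comp_mult by (intro sum.neutral) auto
  qed
  have "hom_comp (r s * s) i = 0" if "s \<in> F" for s
    unfolding hom_comp_mult using prod0[OF that] Suc.prems(2) by (intro sum.neutral) auto
  then show ?case unfolding F(2) hom_comp_sum_distrib by (intro sum.neutral) simp
qed simp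

end

section \<open>Frobenius and \<open>p^e\<close>-linear maps on Cech numerators\<close>

lemma prime_char_eq:
  assumes "prime p" "of_nat p = (0 :: 'a::comm_ring_1)" "(1 :: 'a) \<noteq> 0"
  shows "CHAR('a) = p"
proof -
  have "CHAR('a) dvd p" using assms(2) by (simp add: of_nat_eq_0_iff_char_dvd)
  moreover have "CHAR('a) \<noteq> 1"
    using assms(3) of_nat_eq_0_iff_char_dvd[of 1, where ?'a = 'a] by auto
  ultimately show ?thesis using assms(1) by (metis prime_nat_iff)
qed

text \<open>Raising to the power \<open>q\<close> is a ring endomorphism that fixes signs, and it
  turns the denominator exponent \<open>k\<close> into \<open>k * q\<close>.\<close>

lemma cech_d_frobenius:
  assumes "prime CHAR('a::comm_ring_1)" and q_def: "q = CHAR('a) ^ e"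
  shows "cech_d xs (k * q) (\<lambda>S. c S ^ q) T = (cech_d xs k c T :: 'a) ^ q"
proof -
  \<comment> \<open>Expanding \<open>0 ^ q\<close> yields \<open>(- 1) ^ q = - 1\<close> for even
    \<open>q\<close> as well, without a case split on parity.\<close>
  have "(1 + (- 1) :: 'a) ^ q = 1 ^ q + (- 1) ^ q"
    by (rule freshmans_dream'[OF assms(1)]) (simp add: q_def)
  moreover have "q > 0" using assms(1) by (simp add: q_def prime_gt_0_nat)
  ultimately have "(- 1 :: 'a) ^ q = - 1" by (simp add: eq_neg_iff_add_eq_0 add.commute zero_power)
  then have csign: "(csign T s :: 'a) ^ q = csign T s" for s
    unfolding csign_def by (metis power_mult mult.commute)
  have "cech_d xs k c T ^ q = (\<Sum>s\<in>T. (csign T s * c (T - {s}) * xs ! s ^ k) ^ q)"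
    unfolding cech_d_def by (rule freshmans_dream_sum'[OF assms(1)]) (simp add: q_def)
  then show ?thesis by (simp add: cech_d_def power_mult_distrib csign power_mult)
qed

lemma p_linear_additive:
  assumes "p_linear p e \<phi>"
  shows p_linear_zero: "\<phi> 0 = 0" and p_linear_uminus: "\<phi> (- x) = - \<phi> x"
    and p_linear_sum: "\<phi> (sum f A) = (\<Sum>s\<in>A. \<phi> (f s))"
proof -
  have add: "\<phi> (x + y) = \<phi> x + \<phi> y" for x y using assms by (simp add: p_linear_def)
  show zero: "\<phi> 0 = 0" using add[of 0 0] by simp
  show "\<phi> (- x) = - \<phi> x" using add[of x "- x"] zero by (simp add: eq_neg_iff_add_eq_0 add.commute)
  show "\<phi> (sum f A) = (\<Sum>s\<in>A. \<phi> (f s))"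
    by (induction A rule: infinite_finite_induct) (simp_all add: zero add)
qed

text \<open>The factor \<open>xs ! s ^ (k * p ^ e)\<close> is a \<open>p ^ e\<close>-th power and
  leaves \<open>\<phi>\<close> as \<open>xs ! s ^ k\<close>; signs pass through by
  additivity.\<close>

lemma p_linear_cech_d:
  assumes "p_linear p e \<phi>"
  shows "\<phi> (cech_d xs (k * p ^ e) b T) = cech_d xs k (\<lambda>S. \<phi> (b S)) T"
proof -
  have lin: "\<phi> (r ^ (p ^ e) * x) = r * \<phi> x" for r x using assms by (simp add: p_linear_def)
  have "\<phi> (csign T s * b (T - {s}) * xs ! s ^ (k * p ^ e)) = csign T s * \<phi> (b (T - {s})) * xs ! s ^ k" for s
    using lin[of "xs ! s ^ k" "csign T s * b (T - {s})"] p_linear_uminus[OF assms]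
    by (cases "even (card {t \<in> T. t < s})")
      (simp_all add: csign_def power_mult mult.commute)
  then show ?thesis by (simp add: cech_d_def p_linear_sum[OF assms])
qed

section \<open>Bounding a cocycle by means of a Frobenius splitting\<close>

context standard_graded_ring
begin

text \<open>The factor \<open>xs ! s ^ k\<close> has degree \<open>k\<close>, exactly the gap
  between the degrees attached to \<open>T - {s}\<close> and \<open>T\<close>. A bounding cochain
  without a degree can thus be replaced by its homogeneous part.\<close>

lemma int_comp_cech_d:
  assumes T: "T \<subseteq> {..<length xs}"
  shows "int_comp (cech_d xs k b T) (\<alpha> + int k * int (card T)) =
    cech_d xs k (\<lambda>S. int_comp (b S) (\<alpha> + int k * int (card S))) T"
  unfolding cech_d_def int_comp_sum
proof (rule sum.cong[OF refl])
  fix s assume s: "s \<in> T"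
  from card_Suc_Diff1[OF finite_idx[OF T] s]
  have card: "\<alpha> + int k * int (card T) = (\<alpha> + int k * int (card (T - {s}))) + int k * 1"
    by (simp add: algebra_simps flip: of_nat_Suc) (metis mult_Suc_right of_nat_add of_nat_mult)
  have "xs ! s ^ k \<in> hpiece G (int k * 1)" using T s by (intro hpiece_power xs_mem) auto
  then have "int_comp (csign T s * b (T - {s}) * xs ! s ^ k) (\<alpha> + int k * int (card T)) =
      int_comp (csign T s * b (T - {s})) (\<alpha> + int k * int (card (T - {s}))) * xs ! s ^ k"
    unfolding card by (rule int_comp_mult_homogeneous)
  also have "int_comp (csign T s * b (T - {s})) a = csign T s * int_comp (b (T - {s})) a" for a
    by (cases "even (card {t \<in> T. t < s})") (simp_all add: csign_def int_comp_uminus)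
  finally show "int_comp (csign T s * b (T - {s}) * xs ! s ^ k) (\<alpha> + int k * int (card T)) =
      csign T s * int_comp (b (T - {s})) (\<alpha> + int k * int (card (T - {s}))) * xs ! s ^ k" .
qed

text \<open>With \<open>q = p ^ e\<close>, each homogeneous part of \<open>f\<close> moves
  \<open>c S ^ q\<close> into a degree beyond \<open>D\<close>, so \<open>f * c S ^ q\<close>
  bounds. Applying \<open>\<phi>\<close> undoes the Frobenius and, as \<open>\<phi> f = 1\<close>,
  yields a cochain bounding \<open>c\<close>.\<close>

lemma coboundary_of_splitting:
  assumes p: "prime p" "of_nat p = (0::'a)"
    and \<phi>: "p_linear p e \<phi>" "\<phi> f = 1"
    and f: "\<And>i. i < N \<Longrightarrow> hom_comp f i = 0"
    and van: "\<And>\<beta>. \<beta> > D \<Longrightarrow> cech_vanishes {0} \<beta>"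
    and large: "int (p ^ e) * \<alpha> + int N > D"
    and c: "cochain \<alpha> k c" and dc: "\<And>T. T \<subseteq> {..<length xs} \<Longrightarrow> cech_d xs k c T = 0"
  shows "\<exists>m b. cochain \<alpha> (k + m) b \<and>
    (\<forall>S\<subseteq>{..<length xs}. xprod xs S ^ m * c S = cech_d xs (k + m) b S)"
proof -
  define q where "q = p ^ e"
  have q: "q > 0" using p(1) by (simp add: q_def prime_gt_0_nat)
  have "(1::'a) \<noteq> 0" using standard by (simp add: standard_graded_def degree0_field_def)
  then have char: "CHAR('a) = p" by (rule prime_char_eq[OF p])
  let ?c = "\<lambda>S. c S ^ q"
  have c': "cochain (int q * \<alpha>) (k * q) ?c"
    unfolding cochain_def
  proof (intro allI impI)
    fix S assume "S \<subseteq> {..<length xs}"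
    then have "c S ^ q \<in> hpiece G (int q * (\<alpha> + int k * int (card S)))"
      using c by (intro hpiece_power) (auto simp: cochain_def)
    then show "c S ^ q \<in> hpiece G (int q * \<alpha> + int (k * q) * int (card S))"
      by (simp add: algebra_simps)
  qed
  have dc': "cech_d xs (k * q) ?c T = 0" if "T \<subseteq> {..<length xs}" for T
    using cech_d_frobenius[where ?'a = 'a, of q e xs k c T] p(1) dc[OF that] q
    by (simp add: char q_def[symmetric] zero_power)
  \<comment> \<open>No degree is imposed on \<open>b\<close>: \<open>f\<close> may have components
    in several degrees, and the property has to be closed under sums.\<close>
  define W where "W g \<longleftrightarrow> (\<exists>m b. \<forall>S\<subseteq>{..<length xs}.
      xprod xs S ^ m * (g * ?c S) = cech_d xs (k * q + m) b S)" for g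
  have W_homogeneous: "W g" if g: "g \<in> G d" "d \<ge> N" for g d
  proof -
    have "cochain (int q * \<alpha> + int d) (k * q) (\<lambda>S. g * ?c S)"
      using g(1) by (intro cochain_mult c') (simp add: hpiece_def)
    moreover have "int q * \<alpha> + int d > D" using large g(2) by (simp add: q_def)
    moreover have "cech_d xs (k * q) (\<lambda>S. g * ?c S) T \<in> {0}" if "T \<subseteq> {..<length xs}" for T
      using dc'[OF that] by (simp add: cech_d_scale)
    ultimately obtain m b where "\<And>S. S \<subseteq> {..<length xs} \<Longrightarrow>
        xprod xs S ^ m * (g * ?c S) - cech_d xs (k * q + m) b S \<in> {0}"
      using cech_vanishesD[OF van] by metis
    then show ?thesis unfolding W_def by auto
  qed
  have W_add: "W (g + h)" if gh: "W g" "W h" for g h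
  proof -
    obtain m1 b1 where 1: "\<And>S. S \<subseteq> {..<length xs} \<Longrightarrow>
        xprod xs S ^ m1 * (g * ?c S) = cech_d xs (k * q + m1) b1 S" using gh(1) W_def by auto
    obtain m2 b2 where 2: "\<And>S. S \<subseteq> {..<length xs} \<Longrightarrow>
        xprod xs S ^ m2 * (h * ?c S) = cech_d xs (k * q + m2) b2 S" using gh(2) W_def by auto
    have "xprod xs S ^ (m1 + m2) * ((g + h) * ?c S) = cech_d xs (k * q + (m1 + m2))
        (\<lambda>S. xprod xs S ^ m2 * b1 S + xprod xs S ^ m1 * b2 S) S" if S: "S \<subseteq> {..<length xs}" for S
    proof -
      have "cech_d xs (k * q + (m1 + m2)) (\<lambda>S. xprod xs S ^ m2 * b1 S) S =
          xprod xs S ^ m2 * (xprod xs S ^ m1 * (g * ?c S))"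
        using cech_d_shift[OF finite_idx[OF S], of xs "k * q + m1" m2 b1]
        by (simp add: 1[OF S] add.assoc)
      moreover have "cech_d xs (k * q + (m1 + m2)) (\<lambda>S. xprod xs S ^ m1 * b2 S) S =
          xprod xs S ^ m1 * (xprod xs S ^ m2 * (h * ?c S))"
        using cech_d_shift[OF finite_idx[OF S], of xs "k * q + m2" m1 b2]
        by (simp add: 2[OF S] add.assoc add.commute[of m2])
      ultimately show ?thesis by (simp add: cech_d_add power_add algebra_simps)
    qed
    then show ?thesis unfolding W_def by blast
  qed
  have "W (\<Sum>i\<in>A. hom_comp f i)" for A
  proof (induction A rule: infinite_finite_induct)
    case (insert i A)
    have "W (hom_comp f i)"
    proof (cases "i < N")
      case True
      then show ?thesis using f W_homogeneous[OF G_zero, of N] by simp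
    next
      case False
      then show ?thesis using W_homogeneous[OF hom_comp_mem] by simp
    qed
    then show ?case using insert W_add by simp
  qed (use W_homogeneous[OF G_zero, of N] in simp_all)
  then have "W f" using hom_comp_sum by metis
  then obtain m b where b: "\<And>S. S \<subseteq> {..<length xs} \<Longrightarrow>
      xprod xs S ^ m * (f * ?c S) = cech_d xs (k * q + m) b S" unfolding W_def by blast
  \<comment> \<open>The extra factor turns \<open>xprod xs S ^ m\<close> into a \<open>q\<close>-th
    power, which \<open>\<phi>\<close> can release. The subtraction is exact because
    \<open>q > 0\<close> gives \<open>m \<le> m * q\<close>.\<close>
  define b' where "b' = (\<lambda>S. \<phi> (xprod xs S ^ (m * q - m) * b S))"
  have main: "xprod xs S ^ m * c S = cech_d xs (k + m) b' S" if S: "S \<subseteq> {..<length xs}" for S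
  proof -
    have le: "m + (m * q - m) = m * q" using q by simp
    have exp: "k * q + m + (m * q - m) = (k + m) * q"
      unfolding add.assoc le by (simp add: add_mult_distrib)
    have "cech_d xs ((k + m) * q) (\<lambda>S. xprod xs S ^ (m * q - m) * b S) S =
        xprod xs S ^ (m * q - m) * (xprod xs S ^ m * (f * ?c S))"
      using cech_d_shift[OF finite_idx[OF S], of xs "k * q + m" "m * q - m" b]
      unfolding exp b[OF S] .
    also have "\<dots> = xprod xs S ^ (m + (m * q - m)) * (f * ?c S)"
      by (simp only: power_add mult_ac)
    also have "\<dots> = (xprod xs S ^ m * c S) ^ q * f"
      unfolding le by (simp add: power_mult_distrib power_mult mult_ac)
    finally have "\<phi> ((xprod xs S ^ m * c S) ^ q * f) = cech_d xs (k + m) b' S"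
      using p_linear_cech_d[OF \<phi>(1), of xs "k + m" "\<lambda>S. xprod xs S ^ (m * q - m) * b S" S]
      by (simp add: q_def b'_def)
    moreover have "\<phi> ((xprod xs S ^ m * c S) ^ q * f) = xprod xs S ^ m * c S"
      using \<phi> unfolding p_linear_def q_def by simp
    ultimately show ?thesis by simp
  qed
  \<comment> \<open>The map \<open>\<phi>\<close> need not respect the grading, so \<open>b'\<close>
    may be inhomogeneous. As the cochain it bounds is homogeneous, the components of
    \<open>b'\<close> in the matching degrees bound it too.\<close>
  let ?b = "\<lambda>S. int_comp (b' S) (\<alpha> + int (k + m) * int (card S))"
  have "cochain \<alpha> (k + m) ?b" by (simp add: cochain_def int_comp_mem)
  moreover have "xprod xs S ^ m * c S = cech_d xs (k + m) ?b S" if S: "S \<subseteq> {..<length xs}" for S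
  proof -
    have "xprod xs S ^ m * c S \<in> hpiece G (\<alpha> + int (k + m) * int (card S))"
      using cochain_shift[OF c, of m] S unfolding cochain_def by blast
    from int_comp_hpiece[OF this] show ?thesis
      unfolding main[OF S] int_comp_cech_d[OF S] by simp
  qed
  ultimately show ?thesis by blast
qed

text \<open>Turns a cocycle in the localizations into one whose numerators satisfy the equations
  exactly: it is extended by zero outside the sets of size \<open>i\<close>, and its denominators
  are enlarged by a high power of \<open>xprod\<close>.\<close>

lemma loccoh_nonzero_cocycle:
  assumes "loccoh_nonzero G xs i \<alpha>"
  obtains k c where "cochain \<alpha> k c" "\<And>T. T \<subseteq> {..<length xs} \<Longrightarrow> cech_d xs k c T = 0"
    "\<not> (\<exists>m b. cochain \<alpha> (k + m) b \<and>
        (\<forall>S\<subseteq>{..<length xs}. xprod xs S ^ m * c S = cech_d xs (k + m) b S))"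
proof -
  obtain k c where c: "cech_cochain G xs i \<alpha> k c" "cech_cocycle xs i k c"
      "\<not> cech_coboundary G xs i \<alpha> k c"
    using assms unfolding loccoh_nonzero_def by blast
  define c0 where "c0 S = (if S \<in> idx_sets xs i then c S else 0)" for S
  have c0: "cochain \<alpha> k c0"
    using c(1) by (auto simp: cochain_def c0_def cech_cochain_def hpiece_zero idx_sets_def)
  have "\<forall>T\<in>idx_sets xs (Suc i). \<exists>N. xprod xs T ^ N * cech_d xs k c T = 0"
    using c(2) by (simp add: cech_cocycle_def loc_eq_def)
  then obtain N where N: "\<And>T. T \<in> idx_sets xs (Suc i) \<Longrightarrow> xprod xs T ^ N T * cech_d xs k c T = 0"
    by metis
  \<comment> \<open>A common exponent for all \<open>T\<close>; the finite sum bounds each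
    \<open>N T\<close>.\<close>
  define M where "M = (\<Sum>T\<in>idx_sets xs (Suc i). N T)"
  have fin: "finite (idx_sets xs (Suc i))"
    by (rule finite_subset[of _ "Pow {..<length xs}"]) (auto simp: idx_sets_def)
  have d0: "xprod xs T ^ M * cech_d xs k c0 T = 0" if T: "T \<subseteq> {..<length xs}" for T
  proof (cases "card T = Suc i")
    case True
    then have Ti: "T \<in> idx_sets xs (Suc i)" using T by (simp add: idx_sets_def)
    have "T - {s} \<in> idx_sets xs i" if "s \<in> T" for s
      using T True that finite_idx[OF T] by (auto simp: idx_sets_def)
    then have eq: "cech_d xs k c0 T = cech_d xs k c T"
      unfolding cech_d_def by (intro sum.cong refl) (simp add: c0_def)
    have "N T \<le> M" unfolding M_def by (rule member_le_sum[OF Ti]) (use fin in auto)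
    then have "xprod xs T ^ M = xprod xs T ^ (M - N T) * xprod xs T ^ N T"
      by (simp flip: power_add)
    then show ?thesis using N[OF Ti] by (simp add: eq mult.assoc)
  next
    case False
    \<comment> \<open>The cochain \<open>c0\<close> lives on sets of size \<open>i\<close>, and no
      \<open>T - {s}\<close> has that size here.\<close>
    have "c0 (T - {s}) = 0" if s: "s \<in> T" for s
      using False card_Suc_Diff1[OF finite_idx[OF T] s] by (auto simp: c0_def idx_sets_def)
    then have "cech_d xs k c0 T = 0" unfolding cech_d_def by (intro sum.neutral) simp
    then show ?thesis by simp
  qed
  show ?thesis
  proof (rule that[of "k + M" "\<lambda>S. xprod xs S ^ M * c0 S"])
    show "cochain \<alpha> (k + M) (\<lambda>S. xprod xs S ^ M * c0 S)" by (rule cochain_shift[OF c0])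
    show "cech_d xs (k + M) (\<lambda>S. xprod xs S ^ M * c0 S) T = 0" if "T \<subseteq> {..<length xs}" for T
      using d0[OF that] by (simp add: cech_d_shift finite_idx[OF that])
    show "\<not> (\<exists>m b. cochain \<alpha> (k + M + m) b \<and> (\<forall>S\<subseteq>{..<length xs}.
        xprod xs S ^ m * (xprod xs S ^ M * c0 S) = cech_d xs (k + M + m) b S))"
    proof
      assume "\<exists>m b. cochain \<alpha> (k + M + m) b \<and> (\<forall>S\<subseteq>{..<length xs}.
        xprod xs S ^ m * (xprod xs S ^ M * c0 S) = cech_d xs (k + M + m) b S)"
      then obtain m b where b: "cochain \<alpha> (k + M + m) b" "\<And>S. S \<subseteq> {..<length xs} \<Longrightarrow>
        xprod xs S ^ m * (xprod xs S ^ M * c0 S) = cech_d xs (k + M + m) b S" by blast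
      have bS: "xprod xs S ^ m * (xprod xs S ^ M * c S) = cech_d xs (k + M + m) b S"
        if "S \<in> idx_sets xs i" for S
        using b(2)[of S] that by (auto simp: c0_def idx_sets_def)
      have "cech_coboundary G xs i \<alpha> k c"
      proof (cases i)
        case 0
        \<comment> \<open>Only \<open>S = {}\<close> occurs. Its differential is an empty sum and
          its product of variables is \<open>1\<close>, so bounding forces
          \<open>c S = 0\<close>.\<close>
        have "loc_eq xs S (c S) k 0 0" if S: "S \<in> idx_sets xs 0" for S
        proof -
          have "S = {}" using S finite_idx by (auto simp: idx_sets_def)
          then have "c S = 0" using bS[of S] S 0 by (simp add: xprod_def cech_d_def)
          then show ?thesis by (simp add: loc_eq_def)
        qed
        then show ?thesis by (simp add: cech_coboundary_def 0)
      next
        case (Suc j)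
        have "cech_cochain G xs j \<alpha> (k + M + m) b"
          using b(1) by (auto simp: cech_cochain_def cochain_def idx_sets_def)
        moreover have "loc_eq xs S (c S) k (cech_d xs (k + M + m) b S) (k + M + m)"
          if "S \<in> idx_sets xs i" for S
          unfolding loc_eq_def bS[OF that, symmetric] by (simp add: power_add mult_ac)
        ultimately show ?thesis using Suc by (auto simp: cech_coboundary_def)
      qed
      then show False using c(3) by contradiction
    qed
  qed
qed

lemma pair_F_pure_le:
  assumes p: "prime p" "of_nat p = (0::'a)"
    and lam: "lam \<ge> 0" "pair_F_pure p (irrel_ideal G) lam"
    and coh: "loccoh_nonzero G xs i \<alpha>"
  shows "real_of_int \<alpha> \<le> - lam"
proof (rule ccontr)
  assume "\<not> real_of_int \<alpha> \<le> - lam"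
  then have pos: "lam + real_of_int \<alpha> > 0" by simp
  have "hom_ideal {0}" by (simp add: hom_ideal_def is_ideal_def int_comp_zero)
  then obtain D where D: "\<And>\<beta>. \<beta> > D \<Longrightarrow> cech_vanishes {0} \<beta>"
    using cech_vanishes_large_degree by blast
  obtain e0 where e0: "\<And>e. e \<ge> e0 \<Longrightarrow>
      \<exists>f \<in> ideal_pow (irrel_ideal G) (nat \<lfloor>(real p ^ e - 1) * lam\<rfloor>). \<exists>\<phi>::'a \<Rightarrow> 'a. p_linear p e \<phi> \<and> \<phi> f = 1"
    using lam(2) unfolding pair_F_pure_def by blast
  have p1: "real p > 1" using prime_gt_1_nat[OF p(1)] by simp
  \<comment> \<open>In the numerator, \<open>lam\<close> pays for the \<open>- 1\<close> in
    \<open>p ^ e - 1\<close> and \<open>1\<close> for the floor, so that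
    \<open>p ^ e * \<alpha> + N\<close> exceeds \<open>D\<close>.\<close>
  then obtain n where n: "(lam + 1 + real_of_int D) / (lam + real_of_int \<alpha>) < real p ^ n"
    using real_arch_pow by blast
  define e where "e = max n e0"
  have "real p ^ n \<le> real p ^ e" using p1 by (intro power_increasing) (auto simp: e_def)
  with n have "(lam + 1 + real_of_int D) / (lam + real_of_int \<alpha>) < real p ^ e" by linarith
  then have big: "lam + 1 + real_of_int D < real p ^ e * (lam + real_of_int \<alpha>)"
    using pos by (simp add: divide_less_eq)
  define N where "N = nat \<lfloor>(real p ^ e - 1) * lam\<rfloor>"
  have "real N > (real p ^ e - 1) * lam - 1" unfolding N_def by linarith
  then have "real p ^ e * real_of_int \<alpha> + real N > real_of_int D"
    using big by (simp add: algebra_simps)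
  then have "real_of_int (int (p ^ e) * \<alpha> + int N) > real_of_int D" by simp
  then have large: "int (p ^ e) * \<alpha> + int N > D" by (simp only: of_int_less_iff)
  obtain f \<phi> where f: "f \<in> ideal_pow (irrel_ideal G) N" and \<phi>: "p_linear p e \<phi>" "\<phi> f = (1::'a)"
    using e0[of e] unfolding N_def e_def by auto
  obtain k c where c: "cochain \<alpha> k c" "\<And>T. T \<subseteq> {..<length xs} \<Longrightarrow> cech_d xs k c T = 0"
    and not_bd: "\<not> (\<exists>m b. cochain \<alpha> (k + m) b \<and>
        (\<forall>S\<subseteq>{..<length xs}. xprod xs S ^ m * c S = cech_d xs (k + m) b S))"
    using loccoh_nonzero_cocycle[OF coh] by metis
  show False
    using not_bd coboundary_of_splitting[OF p \<phi> irrel_pow_hom_comp[OF f] D large c] by blast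
qed

end

theorem theorem4p3:
  fixes G :: "nat \<Rightarrow> 'a::comm_ring_1 set" and p :: nat and xs :: "'a list"
  assumes "prime p"
    and "standard_graded G"
    and "of_nat p = (0::'a)"
    and "F_finite p TYPE('a)"
    and "F_pure p TYPE('a)"
    and "spans_deg1 G xs"
  shows "\<forall>i::nat. fpt p (irrel_ideal G) \<le> - a_inv G xs i"
proof
  fix i
  interpret standard_graded_ring G xs
    using assms by unfold_locales (auto simp: standard_graded_def)
  \<comment> \<open>Both invariants are suprema, so it is enough to compare one admissible
    \<open>lam\<close> with one degree of nonzero cohomology.\<close>
  have "ereal lam \<le> - a_inv G xs i" if "lam \<ge> 0" "pair_F_pure p (irrel_ideal G) lam" for lam
  proof -
    have "ereal (real_of_int \<alpha>) \<le> ereal (- lam)" if "loccoh_nonzero G xs i \<alpha>" for \<alpha>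
      using pair_F_pure_le[OF assms(1,3) \<open>lam \<ge> 0\<close> \<open>pair_F_pure p (irrel_ideal G) lam\<close> that] by simp
    then have "a_inv G xs i \<le> ereal (- lam)" unfolding a_inv_def by (auto intro!: Sup_least)
    then show ?thesis using ereal_uminus_le_reorder[of "a_inv G xs i" "ereal lam"]
      by (metis ereal_minus_le_minus ereal_uminus_uminus uminus_ereal.simps(1))
  qed
  then show "fpt p (irrel_ideal G) \<le> - a_inv G xs i"
    unfolding fpt_def by (auto intro!: Sup_least)
qed

end
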